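(* Let $a_0<0<a_1<\dots<a_n$ and consider the one-sheeted hyperboloid $$\frac{x_0^2}{a_0}+\frac{x_1^2}{a_1}+\dots+\frac{x_n^2}{a_n}=1$$ in $\mathbb R^{n+1}$ with the metric induced from the Euclidean metric. Let $x(s)$ be a (complete) geodesic on it, let $y=x'(s)$ be its velocity, and let $$F_0=y_0^2+\sum_{j=1}^n\frac{(x_0y_j-x_jy_0)^2}{a_0-a_j},$$ which is constant along the geodesic. Then: the geodesic crosses the neck ellipsoid $\{x_0=0\}$ if and only if $F_0>0$; when $F_0<0$ the geodesic is reflected back to infinity; and when $F_0=0$ the geodesic exponentially approaches a geodesic on the neck ellipsoid.
   Context: Geodesics are parametrised by Euclidean arc length $s\in\mathbb R$. The neck ellipsoid is the intersection of the hyperboloid with the hyperplane $x_0=0$; "crossing" means that the geodesic passes from one of the sides $x_0>0$, $x_0<0$ to the other. The hyperboloid has two "infinities" ($x_0\to+\infty$ and $x_0\to-\infty$). "Reflected back to infinity" means that the geodesic does not meet the neck ellipsoid and goes to the same infinity as $s\to+\infty$ and as $s\to-\infty$. "Exponentially approaches a geodesic on the neck ellipsoid" means that in one of the time directions ($s\to+\infty$ or $s\to-\infty$) the distance from $x(s)$ to some geodesic lying on the neck ellipsoid decays at least exponentially in $|s|$ (this includes the trivial case when the geodesic itself lies on the neck ellipsoid). *)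

theory Defs
  imports "HOL-Analysis.Analysis"
begin

text \<open>The space \<open>\<real>\<^sup>n\<^sup>+\<^sup>1\<close> with coordinates \<open>(x\<^sub>0, x\<^sub>1, \<dots>, x\<^sub>n)\<close> is the Euclidean space
  \<open>real \<times> (real ^ 'n)\<close>: \<open>x\<^sub>0\<close> is \<open>fst x\<close>, and \<open>x\<^sub>j\<close> is \<open>snd x $ j\<close> for \<open>j :: 'n\<close>, where
  \<open>n = CARD('n)\<close>.\<close>

definition quadratic :: "real \<Rightarrow> ('n::finite \<Rightarrow> real) \<Rightarrow> real \<times> (real ^ 'n) \<Rightarrow> real" where
  "quadratic a0 a x = (fst x)\<^sup>2 / a0 + (\<Sum>j\<in>UNIV. (snd x $ j)\<^sup>2 / a j)"

definition hyperboloid :: "real \<Rightarrow> ('n::finite \<Rightarrow> real) \<Rightarrow> (real \<times> (real ^ 'n)) set" where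
  "hyperboloid a0 a = {x. quadratic a0 a x = 1}"

definition neck :: "real \<Rightarrow> ('n::finite \<Rightarrow> real) \<Rightarrow> (real \<times> (real ^ 'n)) set" where
  "neck a0 a = {x \<in> hyperboloid a0 a. fst x = 0}"

text \<open>\<open>1\<close> is a regular value of \<open>quadratic a0 a\<close>, so the tangent space of the level set is the
  kernel of the differential.\<close>

definition tangent_space ::
  "real \<Rightarrow> ('n::finite \<Rightarrow> real) \<Rightarrow> real \<times> (real ^ 'n) \<Rightarrow> (real \<times> (real ^ 'n)) set" where
  "tangent_space a0 a p = {v. frechet_derivative (quadratic a0 a) (at p) v = 0}"

text \<open>Complete geodesics of the induced metric, parametrised by arc length. The covariant derivative
  of the velocity is the tangential part of the acceleration in the ambient space, so it vanishes
  iff the acceleration is orthogonal to the tangent space. Requiring only that the curve is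
  twice differentiable loses nothing: the resulting equation forces it to be smooth.\<close>

definition geodesic ::
  "real \<Rightarrow> ('n::finite \<Rightarrow> real) \<Rightarrow> (real \<Rightarrow> real \<times> (real ^ 'n)) \<Rightarrow> bool" where
  "geodesic a0 a x \<longleftrightarrow>
     (\<forall>s. x s \<in> hyperboloid a0 a) \<and>
     (\<exists>y z. \<forall>s. (x has_vector_derivative y s) (at s) \<and> norm (y s) = 1 \<and>
        (y has_vector_derivative z s) (at s) \<and>
        (\<forall>v \<in> tangent_space a0 a (x s). z s \<bullet> v = 0))"

definition F0 ::
  "real \<Rightarrow> ('n::finite \<Rightarrow> real) \<Rightarrow> real \<times> (real ^ 'n) \<Rightarrow> real \<times> (real ^ 'n) \<Rightarrow> real" where
  "F0 a0 a x y =
     (fst y)\<^sup>2 + (\<Sum>j\<in>UNIV. (fst x * snd y $ j - snd x $ j * fst y)\<^sup>2 / (a0 - a j))"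

text \<open>The order of \<open>s\<close> and \<open>t\<close> is left open: the neck may be crossed in either direction.\<close>

definition crosses_neck :: "(real \<Rightarrow> real \<times> (real ^ 'n::finite)) \<Rightarrow> bool" where
  "crosses_neck x \<longleftrightarrow> (\<exists>s t. fst (x s) < 0 \<and> 0 < fst (x t))"

definition reflected_to_infinity ::
  "real \<Rightarrow> ('n::finite \<Rightarrow> real) \<Rightarrow> (real \<Rightarrow> real \<times> (real ^ 'n)) \<Rightarrow> bool" where
  "reflected_to_infinity a0 a x \<longleftrightarrow>
     (\<forall>s. x s \<notin> neck a0 a) \<and>
     ((filterlim (\<lambda>s. fst (x s)) at_top at_top \<and> filterlim (\<lambda>s. fst (x s)) at_top at_bot) \<or>
      (filterlim (\<lambda>s. fst (x s)) at_bot at_top \<and> filterlim (\<lambda>s. fst (x s)) at_bot at_bot))"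

text \<open>The neck is totally geodesic in the hyperboloid, being the fixed point set of the isometry
  \<open>x\<^sub>0 \<mapsto> - x\<^sub>0\<close>, so the geodesics of the hyperboloid that lie on the neck are the geodesics of the
  neck itself.\<close>

definition exponentially_approaches_neck_geodesic ::
  "real \<Rightarrow> ('n::finite \<Rightarrow> real) \<Rightarrow> (real \<Rightarrow> real \<times> (real ^ 'n)) \<Rightarrow> bool" where
  "exponentially_approaches_neck_geodesic a0 a x \<longleftrightarrow>
     (\<exists>\<gamma> C k. geodesic a0 a \<gamma> \<and> range \<gamma> \<subseteq> neck a0 a \<and> k > 0 \<and>
        ((\<forall>s\<ge>0. infdist (x s) (range \<gamma>) \<le> C * exp (- k * \<bar>s\<bar>)) \<or>
         (\<forall>s\<le>0. infdist (x s) (range \<gamma>) \<le> C * exp (- k * \<bar>s\<bar>))))"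

end

theory Submission
  imports Defs
begin

text \<open>
  Write \<open>x = (x\<^sub>0, \<xi>)\<close>, \<open>y = (y\<^sub>0, \<eta>)\<close>, \<open>\<alpha> = - a\<^sub>0\<close>, \<open>A = diag (1 / a\<^sub>j)\<close>, \<open>B = diag (1 / (a\<^sub>j + \<alpha>))\<close> and
  \<open>w = x\<^sub>0 \<eta> - y\<^sub>0 \<xi>\<close>. Then \<open>F\<^sub>0 = y\<^sub>0\<^sup>2 - B w \<bullet> w\<close> is constant, so \<open>F\<^sub>0 > 0\<close> bounds \<open>\<bar>y\<^sub>0\<bar>\<close> away from zero and \<open>x\<^sub>0\<close>
  changes sign. On the neck \<open>F\<^sub>0 = y\<^sub>0\<^sup>2 (1 - B \<xi> \<bullet> \<xi>) \<ge> 0\<close>, with equality only if \<open>y\<^sub>0 = 0\<close>, and then \<open>x\<^sub>0\<close>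
  vanishes identically. If \<open>F\<^sub>0 < 0\<close>, comparing \<open>B\<close> with \<open>A\<close> gives \<open>x\<^sub>0 x\<^sub>0'' \<ge> \<delta> / (1 + x\<^sub>0\<^sup>2)\<close>, so \<open>\<bar>x\<^sub>0\<bar>\<close> is convex
  and tends to infinity at both ends.

  If \<open>F\<^sub>0 = 0\<close> and \<open>x\<^sub>0 > 0 > y\<^sub>0\<close>, then \<open>x\<^sub>0\<close> decays exponentially, and the tangent line at \<open>x\<close> meets the
  hyperplane \<open>x\<^sub>0 = 0\<close> in a point \<open>p\<close> of the focal ellipsoid \<open>B p \<bullet> p = 1\<close>. The line through \<open>\<xi>\<close> and the image
  \<open>p - \<alpha> B p\<close> of \<open>p\<close> under the affine map of the Ivory lemma meets the neck in a point \<open>g\<close> near \<open>\<xi>\<close>. The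
  curve \<open>g\<close> is, up to its parametrisation, a geodesic of the neck: its velocity points to \<open>p\<close>, and \<open>p'\<close> lies in the
  span of \<open>p - g\<close> and the normal \<open>A g\<close>. Moreover \<open>\<bar>\<xi> - g\<bar>\<close> is of the order \<open>x\<^sub>0\<^sup>2\<close>. As \<open>s \<rightarrow> - \<infinity>\<close> the curve \<open>g\<close> may have
  finite length, so its half \<open>s \<ge> 0\<close> is continued to a complete geodesic by solving the geodesic equation.
\<close>

section \<open>Differential equations on the half-line\<close>

lemma has_real_derivative_exp_mult:
  "((\<lambda>s. exp (K * s) / K) has_real_derivative exp (K * s)) (at s within S)" if "K \<noteq> (0::real)"
  using that by (auto intro!: derivative_eq_intros)

lemma integral_exp_mult:
  fixes K t :: real assumes "K > 0" "t \<ge> 0"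
  shows "((\<lambda>s. exp (K * s)) has_integral (exp (K * t) - 1) / K) {0..t}"
proof -
  have "((\<lambda>s. exp (K * s)) has_integral (exp (K * t) / K - exp (K * 0) / K)) {0..t}"
    using assms
    by (intro fundamental_theorem_of_calculus)
       (auto simp flip: has_real_derivative_iff_has_vector_derivative intro: has_real_derivative_exp_mult)
  then show ?thesis by (simp add: diff_divide_distrib)
qed

text \<open>Picard iteration for \<open>u s = exp (- K * s) *\<^sub>R w s\<close>: the exponential weight makes the Picard operator
  a contraction on the whole half-line at once.\<close>

lemma lipschitz_ode_half_line:
  fixes f :: "'a::euclidean_space \<Rightarrow> 'a"
  assumes lip: "L-lipschitz_on UNIV f"
  obtains w where "w 0 = w0" "\<And>t. t \<ge> 0 \<Longrightarrow> (w has_vector_derivative f (w t)) (at t within {0..})"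
proof -
  \<comment> \<open>\<open>K\<close> makes the contraction factor \<open>L / K\<close> at most 1/2;
    the summand 1 keeps it positive when \<open>L = 0\<close>.\<close>
  define K where "K = 2 * (L + 1)"
  have L0: "L \<ge> 0" using lip lipschitz_on_nonneg by auto
  then have K: "K > 0" "L / K \<le> 1/2" by (auto simp: K_def field_simps)
  have lipf: "norm (f p - f q) \<le> L * norm (p - q)" for p q
    using lip by (simp add: lipschitz_on_normD)
  have contf: "continuous_on S f" for S
    using lipschitz_on_continuous_on[OF lip] continuous_on_subset by blast
  define g where "g u s = f (exp (K * s) *\<^sub>R apply_bcontfun u s)" for u :: "real \<Rightarrow>\<^sub>C 'a" and s
  have contg: "continuous_on S (g u)" for S u
    unfolding g_def by (intro continuous_on_compose2[OF contf[of UNIV]] continuous_intros) auto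
  have intg: "g u integrable_on {0..t}" for u t
    by (rule integrable_continuous_real[OF contg])
  define J where "J u t = integral {0..t} (g u)" for u t
  have derivJ: "(J u has_vector_derivative g u t) (at t within {0..})" if "t \<ge> 0" for u t
  proof -
    have "(J u has_vector_derivative g u t) (at t within {0..t+1})"
      unfolding J_def by (rule integral_has_vector_derivative[OF contg]) (use that in auto)
    moreover have "at t within {0..t+1} = at t within {0..}"
      by (rule at_within_nhd[of _ "{t-1<..<t+1}"]) auto
    ultimately show ?thesis by simp
  qed
  have contJ: "continuous_on UNIV (J u)" for u
  proof -
    have "continuous_on {0..} (J u)"
      unfolding continuous_on_eq_continuous_within
      by (auto intro: has_vector_derivative_continuous[OF derivJ])
    moreover have "continuous_on {..0} (J u)"
    proof (rule continuous_on_eq)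
      show "continuous_on {..0} (\<lambda>t::real. 0 :: 'a)" by simp
      fix t :: real assume "t \<in> {..0}"
      then have "t = 0 \<or> {0..t} = {}" by auto
      then show "0 = J u t" by (auto simp: J_def)
    qed
    ultimately have "continuous_on ({..0} \<union> {0..}) (J u)"
      by (intro continuous_on_closed_Un) auto
    moreover have "{..0} \<union> {0..} = (UNIV :: real set)" by auto
    ultimately show ?thesis by simp
  qed
  have J0: "J u t = 0" if "t \<le> 0" for u t
  proof -
    have "t = 0 \<or> {0..t} = {}" using that by auto
    then show ?thesis by (auto simp: J_def)
  qed
  \<comment> \<open>The functions live on the whole line, so \<open>max 0 t\<close> continues the
    operator by the constant \<open>w0\<close> to negative arguments.\<close>
  define T where "T u t = exp (- K * max 0 t) *\<^sub>R (w0 + J u t)" for u t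
  have weight: "exp (- K * t) * ((exp (K * t) - 1) / K) \<le> 1 / K" for t
    using K by (simp add: field_simps flip: exp_add)
  have diffT: "norm (T u t - T v t) \<le> 1/2 * norm (u - v)" for u v t
  proof (cases "t \<ge> 0")
    case True
    have "norm (J u t - J v t) = norm (integral {0..t} (\<lambda>s. g u s - g v s))"
      by (simp add: J_def integral_diff intg)
    also have "\<dots> \<le> integral {0..t} (\<lambda>s. (L * norm (u - v)) * exp (K * s))"
    proof (rule integral_norm_bound_integral)
      show "(\<lambda>s. g u s - g v s) integrable_on {0..t}" by (intro integrable_diff intg)
      show "(\<lambda>s. (L * norm (u - v)) * exp (K * s)) integrable_on {0..t}"
        by (intro integrable_continuous_real continuous_intros)
      fix s
      have "norm (g u s - g v s) \<le> L * norm (exp (K * s) *\<^sub>R (apply_bcontfun (u - v) s))"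
        unfolding g_def by (rule order_trans[OF lipf]) (simp add: scaleR_diff_right)
      also have "\<dots> \<le> L * (exp (K * s) * norm (u - v))"
        using L0 norm_bounded[of "u - v" s] by (intro mult_left_mono) (auto intro: mult_left_mono)
      finally show "norm (g u s - g v s) \<le> (L * norm (u - v)) * exp (K * s)"
        by (simp add: mult_ac)
    qed
    also have "\<dots> = (L * norm (u - v)) * ((exp (K * t) - 1) / K)"
      using has_integral_mult_right[OF integral_exp_mult[OF K(1) True], of "L * norm (u - v)"]
      by (rule integral_unique)
    finally have "norm (T u t - T v t) \<le> exp (- K * t) * ((L * norm (u - v)) * ((exp (K * t) - 1) / K))"
      using True unfolding T_def
      by (simp only: norm_scaleR abs_exp_cancel max.absorb2 add_diff_cancel_left flip: scaleR_diff_right)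
         (rule mult_left_mono, auto)
    also have "\<dots> = (L * norm (u - v)) * (exp (- K * t) * ((exp (K * t) - 1) / K))" by (simp add: mult_ac)
    also have "\<dots> \<le> (L * norm (u - v)) * (1 / K)"
      using weight L0 by (intro mult_left_mono) auto
    also have "\<dots> = L / K * norm (u - v)" by simp
    also have "\<dots> \<le> 1/2 * norm (u - v)" using K by (intro mult_right_mono) auto
    finally show ?thesis .
  qed (simp add: T_def J0)
  \<comment> \<open>Together with the contraction estimate this bounds every \<open>T u\<close>,
    because \<open>T u = T 0 + (T u - T 0)\<close>. The linear growth in \<open>t\<close> is
    absorbed by the weight.\<close>
  have zeroT: "norm (T 0 t) \<le> norm w0 + norm (f 0) / K" for t
  proof (cases "t \<ge> 0")
    case True
    have "g 0 = (\<lambda>s. f 0)" by (simp add: g_def fun_eq_iff)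
    then have "J 0 t = t *\<^sub>R f 0" using True by (simp add: J_def)
    then have "norm (T 0 t) \<le> exp (- K * t) * (norm w0 + t * norm (f 0))"
      using True unfolding T_def by (auto intro!: mult_left_mono norm_triangle_le)
    also have "\<dots> = exp (- K * t) * norm w0 + (exp (- K * t) * t) * norm (f 0)" by (simp add: algebra_simps)
    also have "\<dots> \<le> 1 * norm w0 + (1 / K) * norm (f 0)"
    proof (intro add_mono mult_right_mono)
      have "K * t \<le> exp (K * t)" using exp_ge_add_one_self[of "K * t"] by linarith
      then show "exp (- K * t) * t \<le> 1 / K" using K by (simp add: exp_minus field_simps)
    qed (use True K in auto)
    finally show ?thesis by simp
  qed (use K in \<open>simp add: T_def J0\<close>)
  have "T u \<in> bcontfun" for u
  proof (rule bcontfun_normI)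
    show "continuous_on UNIV (T u)"
      unfolding T_def by (intro continuous_intros contJ)
    fix t
    have "norm (T u t) \<le> norm (T u t - T 0 t) + norm (T 0 t)" by (metis diff_add_cancel norm_triangle_ineq)
    then show "norm (T u t) \<le> 1/2 * norm u + (norm w0 + norm (f 0) / K)"
      using diffT[of u t 0] zeroT[of t] by simp
  qed
  then have app: "apply_bcontfun (Bcontfun (T u)) = T u" for u by (simp add: Bcontfun_inverse)
  have "dist (Bcontfun (T u)) (Bcontfun (T v)) \<le> 1/2 * dist u v" for u v
    by (rule dist_bound) (simp only: app dist_norm diffT)
  then obtain u where u: "Bcontfun (T u) = u"
    using banach_fix_type[of "1/2" "\<lambda>u. Bcontfun (T u)"] by auto
  \<comment> \<open>Removing the weight: for \<open>t >= 0\<close> the fixed point equation says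
    \<open>w t = exp (K * t) *\<^sub>R u t\<close>.\<close>
  define w where "w t = w0 + J u t" for t
  have gw: "g u t = f (w t)" if "t \<ge> 0" for t
  proof -
    have "apply_bcontfun u t = T u t" using app[of u] u by simp
    then show ?thesis using that by (simp add: g_def w_def T_def exp_minus_inverse flip: exp_add)
  qed
  show thesis
  proof
    show "w 0 = w0" by (simp add: w_def J0)
    show "(w has_vector_derivative f (w t)) (at t within {0..})" if "t \<ge> 0" for t
      unfolding w_def using derivJ[OF that, of u] gw[OF that]
      by (auto intro!: derivative_eq_intros simp: w_def)
  qed
qed

text \<open>Gronwall's argument in both directions: \<open>E s * exp (- K * s)\<close> is
  nonincreasing and \<open>E s * exp (K * s)\<close> is nondecreasing.\<close>

lemma DERIV_zero_initial_value:
  fixes E E' :: "real \<Rightarrow> real"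
  assumes E': "\<And>s. (E has_real_derivative E' s) (at s)"
    and bd: "\<And>s. \<bar>E' s\<bar> \<le> K * E s" and nonneg: "\<And>s. 0 \<le> E s" and zero: "E s0 = 0"
  shows "E s = 0"
proof -
  have *: "E s \<le> 0" if "s \<ge> s0"
  proof -
    have "((\<lambda>s. E s * exp (- K * s)) has_real_derivative (E' s - K * E s) * exp (- K * s)) (at s)" for s
      by (auto intro!: derivative_eq_intros E' simp: algebra_simps)
    moreover have "(E' s - K * E s) * exp (- K * s) \<le> 0" for s
      using bd[of s] by (intro mult_nonpos_nonneg) auto
    ultimately have "E s * exp (- K * s) \<le> E s0 * exp (- K * s0)"
      by (meson DERIV_nonpos_imp_nonincreasing that)
    then show ?thesis by (simp add: zero mult_le_0_iff)
  qed
  have **: "E s \<le> 0" if "s \<le> s0"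
  proof -
    have "((\<lambda>s. E s * exp (K * s)) has_real_derivative (E' s + K * E s) * exp (K * s)) (at s)" for s
      by (auto intro!: derivative_eq_intros E' simp: algebra_simps)
    moreover have "(E' s + K * E s) * exp (K * s) \<ge> 0" for s
      using bd[of s] by (intro mult_nonneg_nonneg) auto
    ultimately have "E s * exp (K * s) \<le> E s0 * exp (K * s0)"
      by (meson DERIV_nonneg_imp_nondecreasing that)
    then show ?thesis by (simp add: zero mult_le_0_iff)
  qed
  show ?thesis using * ** nonneg[of s] by linarith
qed

text \<open>Uniqueness for \<open>u'' = m u\<close>: the energy \<open>u^2 + v^2\<close> satisfies
  Gronwall's inequality since \<open>|2 u v|\<close> is at most the energy.\<close>

lemma linear_ode_zero:
  fixes u v m :: "real \<Rightarrow> real"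
  assumes u: "\<And>s. (u has_real_derivative v s) (at s)"
    and v: "\<And>s. (v has_real_derivative m s * u s) (at s)"
    and m: "\<And>s. \<bar>m s\<bar> \<le> M" and zero: "u s0 = 0" "v s0 = 0"
  shows "u s = 0"
proof -
  define E where "E s = (u s)\<^sup>2 + (v s)\<^sup>2" for s
  have "E s = 0"
  proof (rule DERIV_zero_initial_value[where E = E and E' = "\<lambda>s. 2 * u s * v s * (1 + m s)" and K = "1 + M" and ?s0.0 = s0])
    fix s
    show "(E has_real_derivative 2 * u s * v s * (1 + m s)) (at s)"
      unfolding E_def by (auto intro!: derivative_eq_intros u v simp: algebra_simps)
    have "\<bar>2 * u s * v s\<bar> \<le> E s"
      using zero_le_power2[of "u s - v s"] zero_le_power2[of "u s + v s"]
      by (simp add: E_def power2_sum power2_diff abs_le_iff)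
    moreover have "\<bar>1 + m s\<bar> \<le> 1 + M" using m[of s] by linarith
    ultimately have "\<bar>2 * u s * v s\<bar> * \<bar>1 + m s\<bar> \<le> E s * (1 + M)"
      by (intro mult_mono) (auto simp: E_def)
    then show "\<bar>2 * u s * v s * (1 + m s)\<bar> \<le> (1 + M) * E s"
      unfolding abs_mult[of "2 * u s * v s"] by (simp only: mult.commute[of "E s"])
    show "0 \<le> E s" by (simp add: E_def)
  qed (simp add: E_def zero)
  then show ?thesis by (simp add: E_def)
qed

lemma filterlim_at_top_of_slope:
  fixes u :: "real \<Rightarrow> real"
  assumes "k > 0" "\<And>s. s \<ge> s1 \<Longrightarrow> u s \<ge> c + k * s"
  shows "filterlim u at_top at_top"
proof (rule filterlim_at_top_mono)
  show "filterlim (\<lambda>s. c + k * s) at_top at_top"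
    by (intro filterlim_tendsto_add_at_top[OF tendsto_const] filterlim_tendsto_pos_mult_at_top[OF tendsto_const]
        filterlim_ident assms)
  show "\<forall>\<^sub>F s in at_top. c + k * s \<le> u s"
    using assms(2) eventually_at_top_linorder by blast
qed

text \<open>While \<open>u\<close> stays bounded, \<open>u''\<close> is bounded below; hence \<open>u\<close> increases somewhere, and it is convex.\<close>

lemma convex_filterlim_at_top:
  fixes u v v' :: "real \<Rightarrow> real"
  assumes u: "\<And>s. (u has_real_derivative v s) (at s)"
    and v: "\<And>s. (v has_real_derivative v' s) (at s)"
    and pos: "\<And>s. u s > 0"
    and bd: "\<And>s. u s * v' s * (1 + (u s)\<^sup>2) \<ge> \<delta>" and \<delta>: "\<delta> > 0"
  shows "filterlim u at_top at_top"
proof -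
  have v'pos: "v' s > 0" for s
  proof -
    have "0 < (u s * (1 + (u s)\<^sup>2)) * v' s" using bd[of s] \<delta> by (simp add: mult_ac)
    moreover have "0 < u s * (1 + (u s)\<^sup>2)" using pos[of s] by (simp add: add_pos_nonneg)
    ultimately show ?thesis by (simp add: zero_less_mult_iff)
  qed
  have v_mono: "v s \<le> v t" if "s \<le> t" for s t
    using that v v'pos by (meson DERIV_nonneg_imp_nondecreasing less_imp_le)
  have "\<exists>s. v s > 0"
  proof (rule ccontr)
    assume "\<not> ?thesis"
    then have vneg: "v s \<le> 0" for s by (simp add: not_less)
    \<comment> \<open>While \<open>v <= 0\<close>, \<open>u\<close> stays below its initial value
      \<open>U\<close> for \<open>s >= 0\<close>, which turns the hypothesis into a uniform bound
      \<open>v' >= \<epsilon>\<close>. Then \<open>v\<close> is at least 1 at time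
      \<open>(1 - v 0) / \<epsilon>\<close>.\<close>
    define U where "U = u 0"
    define \<epsilon> where "\<epsilon> = \<delta> / (U * (1 + U\<^sup>2))"
    have U: "U > 0" by (simp add: U_def pos)
    then have W: "U * (1 + U\<^sup>2) > 0" by (simp add: add_pos_nonneg)
    have "v' s \<ge> \<epsilon>" if "s \<ge> 0" for s
    proof -
      have "u s \<le> U" unfolding U_def using that u vneg by (meson DERIV_nonpos_imp_nonincreasing)
      then have "u s * (1 + (u s)\<^sup>2) \<le> U * (1 + U\<^sup>2)"
        using pos[of s] U by (intro mult_mono add_left_mono power_mono) auto
      then have "v' s * (u s * (1 + (u s)\<^sup>2)) \<le> v' s * (U * (1 + U\<^sup>2))"
        using v'pos[of s] by (intro mult_left_mono) auto
      then have "\<delta> \<le> v' s * (U * (1 + U\<^sup>2))" using bd[of s] by (simp add: mult_ac)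
      then show ?thesis using W by (simp add: \<epsilon>_def pos_divide_le_eq)
    qed
    then have *: "v 0 - \<epsilon> * 0 \<le> v t - \<epsilon> * t" if "t \<ge> 0" for t
    proof (intro DERIV_nonneg_imp_nondecreasing[OF that, of "\<lambda>s. v s - \<epsilon> * s"])
      fix s :: real assume "0 \<le> s"
      have "((\<lambda>s. v s - \<epsilon> * s) has_real_derivative v' s - \<epsilon>) (at s)"
        by (auto intro!: derivative_eq_intros v)
      then show "\<exists>y. ((\<lambda>s. v s - \<epsilon> * s) has_real_derivative y) (at s) \<and> 0 \<le> y"
        using \<open>\<And>s. s \<ge> 0 \<Longrightarrow> v' s \<ge> \<epsilon>\<close>[OF \<open>0 \<le> s\<close>] by (intro exI[of _ "v' s - \<epsilon>"]) auto
    qed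
    have e0: "\<epsilon> > 0" using W \<delta> by (simp add: \<epsilon>_def)
    have "v 0 + \<epsilon> * ((1 - v 0) / \<epsilon>) \<le> v ((1 - v 0) / \<epsilon>)"
      using *[of "(1 - v 0) / \<epsilon>"] e0 vneg[of 0] by simp
    then show False using vneg[of "(1 - v 0) / \<epsilon>"] e0 by simp
  qed
  then obtain s1 where s1: "v s1 > 0" by blast
  have "u s1 - v s1 * s1 \<le> u s - v s1 * s" if "s \<ge> s1" for s
  proof (intro DERIV_nonneg_imp_nondecreasing[OF that, of "\<lambda>s. u s - v s1 * s"])
    fix t assume "s1 \<le> t"
    have "((\<lambda>s. u s - v s1 * s) has_real_derivative v t - v s1) (at t)"
      by (auto intro!: derivative_eq_intros u)
    then show "\<exists>y. ((\<lambda>s. u s - v s1 * s) has_real_derivative y) (at t) \<and> 0 \<le> y"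
      using v_mono[OF \<open>s1 \<le> t\<close>] by (intro exI[of _ "v t - v s1"]) auto
  qed
  then show ?thesis
    by (intro filterlim_at_top_of_slope[of "v s1" s1 "u s1 - v s1 * s1"] s1) (force simp: algebra_simps)
qed

section \<open>Geodesics of ellipsoids\<close>

definition diag :: "('n \<Rightarrow> real) \<Rightarrow> real ^ 'n::finite \<Rightarrow> real ^ 'n" where
  "diag f v = (\<chi> j. f j * v $ j)"

lemma diag_nth [simp]: "diag f v $ j = f j * v $ j"
  by (simp add: diag_def)

lemma linear_diag: "linear (diag f)"
  by (rule linearI) (simp_all add: vec_eq_iff algebra_simps)

lemma bounded_linear_diag: "bounded_linear (diag f)"
  using linear_diag linear_conv_bounded_linear by blast

lemmas diag_simps [simp] =
  linear_add[OF linear_diag] linear_diff[OF linear_diag] linear_cmul[OF linear_diag]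
  linear_neg[OF linear_diag] linear_0[OF linear_diag]

lemma has_vector_derivative_diag [derivative_intros]:
  assumes "(g has_vector_derivative g') F"
  shows "((\<lambda>t. diag f (g t)) has_vector_derivative diag f g') F"
  by (rule bounded_linear.has_vector_derivative[OF bounded_linear_diag assms])

lemma inner_diag: "v \<bullet> diag f w = diag f v \<bullet> w"
  by (simp add: inner_vec_def algebra_simps)

lemma inner_diag_sym: "diag f v \<bullet> w = diag f w \<bullet> v"
  by (metis inner_commute inner_diag)

lemma diag_commute: "diag f (diag g v) = diag g (diag f v)"
  by (simp add: vec_eq_iff)

lemma inner_diag_self: "diag f v \<bullet> v = (\<Sum>j\<in>UNIV. f j * (v $ j)\<^sup>2)"
  by (simp add: inner_vec_def power2_eq_square algebra_simps)

lemma inner_diag_self_mono: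
  assumes "\<And>j. f j \<le> g j" shows "diag f v \<bullet> v \<le> diag g v \<bullet> v"
  unfolding inner_diag_self by (intro sum_mono mult_right_mono assms) auto

lemma diag_const: "diag (\<lambda>j. c) v = c *\<^sub>R v"
  by (simp add: vec_eq_iff)

lemma inner_diag_self_le:
  assumes "\<And>j. f j \<le> c" shows "diag f v \<bullet> v \<le> c * (v \<bullet> v)"
  using inner_diag_self_mono[of f "\<lambda>j. c" v] assms by (simp add: diag_const)

lemma inner_diag_self_ge:
  assumes "\<And>j. c \<le> f j" shows "c * (v \<bullet> v) \<le> diag f v \<bullet> v"
  using inner_diag_self_mono[of "\<lambda>j. c" f v] assms by (simp add: diag_const)

lemma inner_diag_self_nonneg: "(\<And>j. 0 \<le> f j) \<Longrightarrow> 0 \<le> diag f v \<bullet> v"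
  by (simp add: inner_diag_self sum_nonneg)

lemma inner_diag_diag_self_ge:
  assumes "\<And>j. c \<le> f j" "\<And>j. 0 \<le> f j"
  shows "c * (diag f v \<bullet> v) \<le> diag f v \<bullet> diag f v"
proof -
  have "c * (diag f v \<bullet> v) = (\<Sum>j\<in>UNIV. c * (f j * (v $ j)\<^sup>2))"
    by (simp add: inner_diag_self sum_distrib_left)
  also have "\<dots> \<le> (\<Sum>j\<in>UNIV. f j * (f j * (v $ j)\<^sup>2))"
    by (intro sum_mono mult_right_mono assms mult_nonneg_nonneg) auto
  also have "\<dots> = diag f v \<bullet> diag f v"
    by (simp add: inner_vec_def power2_eq_square mult_ac)
  finally show ?thesis .
qed

lemma inner_diag_diag_self_le:
  assumes "\<And>j. f j \<le> c" "\<And>j. 0 \<le> f j"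
  shows "diag f v \<bullet> diag f v \<le> c * (diag f v \<bullet> v)"
proof -
  have "diag f v \<bullet> diag f v = (\<Sum>j\<in>UNIV. f j * (f j * (v $ j)\<^sup>2))"
    by (simp add: inner_vec_def power2_eq_square mult_ac)
  also have "\<dots> \<le> (\<Sum>j\<in>UNIV. c * (f j * (v $ j)\<^sup>2))"
    by (intro sum_mono mult_right_mono assms mult_nonneg_nonneg) auto
  also have "\<dots> = c * (diag f v \<bullet> v)"
    by (simp add: inner_diag_self sum_distrib_left)
  finally show ?thesis .
qed

lemma has_real_derivative_inner [derivative_intros]:
  assumes "(f has_vector_derivative f') (at t within S)" "(g has_vector_derivative g') (at t within S)"
  shows "((\<lambda>t. f t \<bullet> g t) has_real_derivative (f t \<bullet> g' + f' \<bullet> g t)) (at t within S)"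
  using bounded_bilinear.has_vector_derivative[OF bounded_bilinear_inner assms]
  by (simp add: has_real_derivative_iff_has_vector_derivative)

section \<open>Bounded Lipschitz functions, for truncating the geodesic field\<close>

text \<open>Boundedness is part of the notion because it keeps products Lipschitz.\<close>

definition bounded_lipschitz :: "('a::metric_space \<Rightarrow> real) \<Rightarrow> bool" where
  "bounded_lipschitz h \<longleftrightarrow>
     (\<exists>L B. \<forall>p q. \<bar>h p - h q\<bar> \<le> L * dist p q \<and> \<bar>h p\<bar> \<le> B)"

lemma bounded_lipschitzE:
  assumes "bounded_lipschitz h"
  obtains L B where "L \<ge> 0" "B \<ge> 0" "\<And>p q. \<bar>h p - h q\<bar> \<le> L * dist p q" "\<And>p. \<bar>h p\<bar> \<le> B"
proof -
  obtain L B where *: "\<And>p q. \<bar>h p - h q\<bar> \<le> L * dist p q" "\<And>p. \<bar>h p\<bar> \<le> B"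
    using assms unfolding bounded_lipschitz_def by metis
  have "\<bar>h p - h q\<bar> \<le> max L 0 * dist p q" for p q
    using *(1)[of p q] by (smt (verit) mult_right_mono zero_le_dist max_def)
  moreover have "B \<ge> 0" using *(2)[of undefined] by linarith
  ultimately show thesis using * by (intro that[of "max L 0" B]) auto
qed

lemma bounded_lipschitz_const: "bounded_lipschitz (\<lambda>p. c)"
  unfolding bounded_lipschitz_def by (rule exI[of _ 0]) auto

lemma bounded_lipschitz_add:
  assumes "bounded_lipschitz h" "bounded_lipschitz k"
  shows "bounded_lipschitz (\<lambda>p. h p + k p)"
proof -
  obtain L B where 1: "\<And>p q. \<bar>h p - h q\<bar> \<le> L * dist p q" "\<And>p. \<bar>h p\<bar> \<le> B"
    using bounded_lipschitzE[OF assms(1)] by metis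
  obtain M C where 2: "\<And>p q. \<bar>k p - k q\<bar> \<le> M * dist p q" "\<And>p. \<bar>k p\<bar> \<le> C"
    using bounded_lipschitzE[OF assms(2)] by metis
  have "\<bar>h p + k p - (h q + k q)\<bar> \<le> (L + M) * dist p q \<and> \<bar>h p + k p\<bar> \<le> B + C" for p q
    using 1(1)[of p q] 1(2)[of p] 2(1)[of p q] 2(2)[of p] unfolding distrib_right by linarith
  then show ?thesis unfolding bounded_lipschitz_def by blast
qed

lemma bounded_lipschitz_mult:
  assumes "bounded_lipschitz h" "bounded_lipschitz k"
  shows "bounded_lipschitz (\<lambda>p. h p * k p)"
proof -
  obtain L B where 1: "B \<ge> 0" "\<And>p q. \<bar>h p - h q\<bar> \<le> L * dist p q" "\<And>p. \<bar>h p\<bar> \<le> B"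
    using bounded_lipschitzE[OF assms(1)] by metis
  obtain M C where 2: "C \<ge> 0" "\<And>p q. \<bar>k p - k q\<bar> \<le> M * dist p q" "\<And>p. \<bar>k p\<bar> \<le> C"
    using bounded_lipschitzE[OF assms(2)] by metis
  have "\<bar>h p * k p - h q * k q\<bar> \<le> (B * M + L * C) * dist p q \<and> \<bar>h p * k p\<bar> \<le> B * C" for p q
  proof
    have "h p * k p - h q * k q = h p * (k p - k q) + (h p - h q) * k q" by (simp add: algebra_simps)
    then have "\<bar>h p * k p - h q * k q\<bar> \<le> \<bar>h p\<bar> * \<bar>k p - k q\<bar> + \<bar>h p - h q\<bar> * \<bar>k q\<bar>"
      by (metis abs_mult abs_triangle_ineq)
    also have "\<dots> \<le> B * (M * dist p q) + (L * dist p q) * C"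
      by (intro add_mono mult_mono 1 2 order_trans[OF abs_ge_zero 1(2)]) auto
    finally show "\<bar>h p * k p - h q * k q\<bar> \<le> (B * M + L * C) * dist p q" by (simp add: algebra_simps)
    show "\<bar>h p * k p\<bar> \<le> B * C" unfolding abs_mult by (intro mult_mono 1 2) auto
  qed
  then show ?thesis unfolding bounded_lipschitz_def by blast
qed

lemma bounded_lipschitz_sum:
  assumes "\<And>j. j \<in> J \<Longrightarrow> bounded_lipschitz (h j)"
  shows "bounded_lipschitz (\<lambda>p. \<Sum>j\<in>J. h j p)"
  using assms
  by (induction J rule: infinite_finite_induct)
     (auto intro: bounded_lipschitz_const bounded_lipschitz_add)

lemma bounded_lipschitz_inverse_max:
  assumes "bounded_lipschitz h" "\<epsilon> > 0"
  shows "bounded_lipschitz (\<lambda>p. inverse (max \<epsilon> (h p)))"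
proof -
  obtain L where L: "L \<ge> 0" "\<And>p q. \<bar>h p - h q\<bar> \<le> L * dist p q"
    using bounded_lipschitzE[OF assms(1)] by metis
  have "\<bar>inverse (max \<epsilon> (h p)) - inverse (max \<epsilon> (h q))\<bar> \<le> (L / (\<epsilon> * \<epsilon>)) * dist p q \<and>
        \<bar>inverse (max \<epsilon> (h p))\<bar> \<le> inverse \<epsilon>" for p q
  proof
    let ?s = "max \<epsilon> (h p)" and ?t = "max \<epsilon> (h q)"
    have st: "?s \<ge> \<epsilon>" "?t \<ge> \<epsilon>" by auto
    have "inverse ?s - inverse ?t = (?t - ?s) / (?s * ?t)" using st assms(2) by (simp add: field_simps)
    then have "\<bar>inverse ?s - inverse ?t\<bar> = \<bar>?t - ?s\<bar> / (?s * ?t)"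
      using st assms(2) by (simp add: abs_mult)
    also have "\<dots> \<le> (L * dist p q) / (\<epsilon> * \<epsilon>)"
    proof (rule frac_le)
      show "\<bar>?t - ?s\<bar> \<le> L * dist p q" using L(2)[of p q] by linarith
      show "\<epsilon> * \<epsilon> \<le> ?s * ?t" using st assms(2) by (intro mult_mono) auto
    qed (use L assms in auto)
    finally show "\<bar>inverse ?s - inverse ?t\<bar> \<le> (L / (\<epsilon> * \<epsilon>)) * dist p q" by simp
    show "\<bar>inverse ?s\<bar> \<le> inverse \<epsilon>" using st assms(2) by (simp add: le_imp_inverse_le)
  qed
  then show ?thesis unfolding bounded_lipschitz_def by blast
qed

definition clamp1 :: "real \<Rightarrow> real \<Rightarrow> real" where
  "clamp1 R t = max (- R) (min R t)"

lemma clamp1_eq: "\<bar>t\<bar> \<le> R \<Longrightarrow> clamp1 R t = t"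
  by (auto simp: clamp1_def)

lemma bounded_lipschitz_clamp1:
  assumes "\<And>p q. \<bar>h p - h q\<bar> \<le> dist p q" "R \<ge> 0"
  shows "bounded_lipschitz (\<lambda>p. clamp1 R (h p))"
proof -
  have "\<bar>clamp1 R (h p) - clamp1 R (h q)\<bar> \<le> 1 * dist p q \<and> \<bar>clamp1 R (h p)\<bar> \<le> R" for p q
    using assms(1)[of p q] assms(2) by (auto simp: clamp1_def)
  then show ?thesis unfolding bounded_lipschitz_def by blast
qed

lemma lipschitz_on_vec:
  fixes h :: "'a::metric_space \<Rightarrow> real ^ 'n::finite"
  assumes "\<And>j. bounded_lipschitz (\<lambda>p. h p $ j)"
  shows "\<exists>L. L-lipschitz_on UNIV h"
proof -
  have "\<exists>L\<ge>0. \<forall>p q. \<bar>h p $ j - h q $ j\<bar> \<le> L * dist p q" for j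
    using bounded_lipschitzE[OF assms[of j]] by metis
  then obtain L where L: "\<And>j. L j \<ge> 0" "\<And>j p q. \<bar>h p $ j - h q $ j\<bar> \<le> L j * dist p q" by metis
  have "(\<Sum>j\<in>UNIV. L j)-lipschitz_on UNIV h"
  proof (rule lipschitz_onI)
    fix p q
    have "dist (h p) (h q) \<le> (\<Sum>j\<in>UNIV. \<bar>(h p - h q) $ j\<bar>)" 
      unfolding dist_norm by (rule norm_le_l1_cart)
    also have "\<dots> \<le> (\<Sum>j\<in>UNIV. L j * dist p q)" using L by (intro sum_mono) auto
    finally show "dist (h p) (h q) \<le> (\<Sum>j\<in>UNIV. L j) * dist p q" by (simp add: sum_distrib_right)
  qed (use L in \<open>auto intro: sum_nonneg\<close>)
  then show ?thesis by blast
qed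

section \<open>The geodesic flow of an ellipsoid\<close>

definition unit_tangent :: "('n::finite \<Rightarrow> real) \<Rightarrow> real ^ 'n \<Rightarrow> real ^ 'n \<Rightarrow> bool" where
  "unit_tangent a g u \<longleftrightarrow>
     diag (\<lambda>j. 1 / a j) g \<bullet> g = 1 \<and> diag (\<lambda>j. 1 / a j) g \<bullet> u = 0 \<and> u \<bullet> u = 1"

text \<open>The acceleration of a geodesic is a multiple of the normal \<open>A g\<close>; the
  factor is forced by differentiating \<open>A g . u = 0\<close> along
  \<open>g' = u\<close>.\<close>

definition ellipsoid_accel :: "('n::finite \<Rightarrow> real) \<Rightarrow> real ^ 'n \<Rightarrow> real ^ 'n \<Rightarrow> real ^ 'n" where
  "ellipsoid_accel a g u =
     - ((diag (\<lambda>j. 1 / a j) u \<bullet> u) / (diag (\<lambda>j. 1 / a j) g \<bullet> diag (\<lambda>j. 1 / a j) g)) *\<^sub>R diag (\<lambda>j. 1 / a j) g"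

text \<open>An explicit substitute for compactness of the unit tangent bundle. The inequalities are
  strict so that they cut out an open neighbourhood of it, on which a truncated field can still
  agree with the geodesic equation.\<close>

lemma unit_tangent_bounds:
  fixes a :: "'n::finite \<Rightarrow> real"
  assumes pos: "\<And>j. 0 < a j"
  obtains R \<epsilon> where "R > 0" "\<epsilon> > 0"
    "\<And>g u. unit_tangent a g u \<Longrightarrow> norm g < R \<and> norm u < R \<and>
       \<epsilon> < diag (\<lambda>j. 1 / a j) g \<bullet> diag (\<lambda>j. 1 / a j) g"
proof -
  define M where "M = Max (range a)"
  have M: "a j \<le> M" for j unfolding M_def by (intro Max_ge) auto
  have M0: "M > 0" using pos[of undefined] M[of undefined] by linarith
  have iM: "1 / M \<le> 1 / a j" for j using M[of j] pos[of j] by (simp add: frac_le)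
  have "norm g < M + 2 \<and> norm u < M + 2 \<and> 1 / (2 * M) < diag (\<lambda>j. 1 / a j) g \<bullet> diag (\<lambda>j. 1 / a j) g"
    if "unit_tangent a g u" for g u
  proof (intro conjI)
    have g: "diag (\<lambda>j. 1 / a j) g \<bullet> g = 1" and u: "norm u = 1"
      using that by (auto simp: unit_tangent_def norm_eq_sqrt_inner)
    have "1 / M * (g \<bullet> g) \<le> 1"
      using inner_diag_self_ge[of "1 / M" "\<lambda>j. 1 / a j" g] iM g by simp
    then have "g \<bullet> g \<le> M" using M0 by (simp add: pos_divide_le_eq)
    then have "(norm g)\<^sup>2 \<le> M" by (simp only: power2_norm_eq_inner)
    also have "\<dots> < M\<^sup>2 + 4 * M + 4" using M0 zero_le_power2[of M] by linarith
    also have "\<dots> = (M + 2)\<^sup>2" by (simp add: power2_sum)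
    finally show "norm g < M + 2" using M0 by (intro power_less_imp_less_base[of "norm g" 2]) auto
    show "norm u < M + 2" using u M0 by simp
    have "1 / (2 * M) < 1 / M" using M0 by (simp add: field_simps)
    also have "\<dots> \<le> diag (\<lambda>j. 1 / a j) g \<bullet> diag (\<lambda>j. 1 / a j) g"
      using inner_diag_diag_self_ge[of "1 / M" "\<lambda>j. 1 / a j" g] iM pos g by (simp add: less_imp_le)
    finally show "1 / (2 * M) < diag (\<lambda>j. 1 / a j) g \<bullet> diag (\<lambda>j. 1 / a j) g" .
  qed
  then show thesis using M0 by (intro that[of "M + 2" "1 / (2 * M)"]) auto
qed

text \<open>The geodesic field is only locally Lipschitz and singular where \<open>A g = 0\<close>.
  Clamping all coordinates and cutting the denominator off at \<epsilon> makes it globally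
  Lipschitz.\<close>

lemma truncated_field:
  fixes a :: "'n::finite \<Rightarrow> real"
  assumes R: "R > 0" and e: "\<epsilon> > 0"
  obtains f L where "L-lipschitz_on UNIV f"
    "\<And>g u. norm g \<le> R \<Longrightarrow> norm u \<le> R \<Longrightarrow> \<epsilon> \<le> diag (\<lambda>j. 1 / a j) g \<bullet> diag (\<lambda>j. 1 / a j) g \<Longrightarrow>
        f (g, u) = (u, ellipsoid_accel a g u)"
proof -
  define cg where "cg j p = clamp1 R (fst p $ j)" for j :: 'n and p :: "(real^'n) \<times> (real^'n)"
  define cu where "cu j p = clamp1 R (snd p $ j)" for j :: 'n and p :: "(real^'n) \<times> (real^'n)"
  have cg: "bounded_lipschitz (cg j)" for j
    unfolding cg_def
  proof (rule bounded_lipschitz_clamp1)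
    fix p q :: "(real^'n) \<times> (real^'n)"
    show "\<bar>fst p $ j - fst q $ j\<bar> \<le> dist p q"
      using dist_fst_le[of p q] dist_vec_nth_le[of "fst p" j "fst q"] by (simp add: dist_real_def)
  qed (use R in auto)
  have cu: "bounded_lipschitz (cu j)" for j
    unfolding cu_def
  proof (rule bounded_lipschitz_clamp1)
    fix p q :: "(real^'n) \<times> (real^'n)"
    show "\<bar>snd p $ j - snd q $ j\<bar> \<le> dist p q"
      using dist_snd_le[of p q] dist_vec_nth_le[of "snd p" j "snd q"] by (simp add: dist_real_def)
  qed (use R in auto)
  define m where "m p = (\<Sum>j\<in>UNIV. 1 / a j * (cu j p * cu j p)) *
    inverse (max \<epsilon> (\<Sum>j\<in>UNIV. (1 / a j * cg j p) * (1 / a j * cg j p)))" for p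
  have m: "bounded_lipschitz m"
    unfolding m_def
    by (intro bounded_lipschitz_mult bounded_lipschitz_inverse_max bounded_lipschitz_sum
        bounded_lipschitz_const cg cu e)
  define f1 :: "(real^'n) \<times> (real^'n) \<Rightarrow> real^'n" where "f1 p = (\<chi> j. cu j p)" for p
  define f2 :: "(real^'n) \<times> (real^'n) \<Rightarrow> real^'n" where "f2 p = (\<chi> j. (- 1 * m p) * (1 / a j * cg j p))" for p
  obtain L1 where L1: "L1-lipschitz_on UNIV f1"
    using lipschitz_on_vec[of f1] cu by (auto simp: f1_def)
  have "bounded_lipschitz (\<lambda>p. f2 p $ j)" for j
    unfolding f2_def vec_lambda_beta by (intro bounded_lipschitz_mult bounded_lipschitz_const cg m)
  then obtain L2 where L2: "L2-lipschitz_on UNIV f2" using lipschitz_on_vec[of f2] by auto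
  show thesis
  proof
    show "(sqrt (L1\<^sup>2 + L2\<^sup>2))-lipschitz_on UNIV (\<lambda>p. (f1 p, f2 p))"
      by (intro lipschitz_on_Pair L1 L2)
    fix g u :: "real^'n"
    assume *: "norm g \<le> R" "norm u \<le> R" "\<epsilon> \<le> diag (\<lambda>j. 1 / a j) g \<bullet> diag (\<lambda>j. 1 / a j) g"
    have c: "cg j (g, u) = g $ j" "cu j (g, u) = u $ j" for j
      using component_le_norm_cart[of g j] component_le_norm_cart[of u j] *
      by (auto simp: cg_def cu_def intro!: clamp1_eq)
    have "m (g, u) = (diag (\<lambda>j. 1 / a j) u \<bullet> u) / (diag (\<lambda>j. 1 / a j) g \<bullet> diag (\<lambda>j. 1 / a j) g)"
      using *(3) by (simp add: m_def c inner_vec_def divide_inverse mult.assoc max_def)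
    then show "(f1 (g, u), f2 (g, u)) = (u, ellipsoid_accel a g u)"
      by (simp add: f1_def f2_def c vec_eq_iff ellipsoid_accel_def)
  qed
qed

text \<open>The truncated equation has a solution for all \<open>t >= 0\<close>. It solves the true
  equation because the unit tangent bundle is invariant: along the solution, membership is both an
  open and a closed condition.\<close>

lemma ellipsoid_geodesic_half_line:
  fixes a :: "'n::finite \<Rightarrow> real"
  assumes pos: "\<And>j. 0 < a j" and init: "unit_tangent a g0 u0"
  obtains g u where "g 0 = g0" "u 0 = u0"
    "\<And>t. t \<ge> 0 \<Longrightarrow> (g has_vector_derivative u t) (at t within {0..})"
    "\<And>t. t \<ge> 0 \<Longrightarrow> (u has_vector_derivative ellipsoid_accel a (g t) (u t)) (at t within {0..})"
    "\<And>t. t \<ge> 0 \<Longrightarrow> unit_tangent a (g t) (u t)"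
proof -
  let ?A = "diag (\<lambda>j. 1 / a j)"
  obtain R \<epsilon> where R: "R > 0" "\<epsilon> > 0" and bd:
    "\<And>g u. unit_tangent a g u \<Longrightarrow> norm g < R \<and> norm u < R \<and> \<epsilon> < ?A g \<bullet> ?A g"
    by (rule unit_tangent_bounds[of a, OF pos]) (rule that)
  obtain f L where lip: "L-lipschitz_on UNIV f" and f:
    "\<And>g u. norm g \<le> R \<Longrightarrow> norm u \<le> R \<Longrightarrow> \<epsilon> \<le> ?A g \<bullet> ?A g \<Longrightarrow> f (g, u) = (u, ellipsoid_accel a g u)"
    by (rule truncated_field[OF R, of a]) (rule that)
  obtain w where w0: "w 0 = (g0, u0)"
    and w: "\<And>t. t \<ge> 0 \<Longrightarrow> (w has_vector_derivative f (w t)) (at t within {0..})"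
    by (rule lipschitz_ode_half_line[OF lip, of "(g0, u0)"]) (rule that)
  define g u where "g t = fst (w t)" and "u t = snd (w t)" for t
  have g': "(g has_vector_derivative fst (f (w t))) (at t within {0..})" if "t \<ge> 0" for t
    unfolding g_def using bounded_linear.has_vector_derivative[OF bounded_linear_fst w[OF that]] .
  have u': "(u has_vector_derivative snd (f (w t))) (at t within {0..})" if "t \<ge> 0" for t
    unfolding u_def using bounded_linear.has_vector_derivative[OF bounded_linear_snd w[OF that]] .
  have conts: "continuous_on {0..} g" "continuous_on {0..} u"
    unfolding continuous_on_eq_continuous_within
    by (auto intro: has_vector_derivative_continuous[OF g'] has_vector_derivative_continuous[OF u'])
  have contA: "continuous_on {0..} (\<lambda>t. ?A (g t))"
    by (intro bounded_linear.continuous_on[OF bounded_linear_diag] conts)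
  define D where "D = {t\<in>{0..}. norm (g t) < R \<and> norm (u t) < R \<and> \<epsilon> < ?A (g t) \<bullet> ?A (g t)}"
  have fD: "fst (f (w t)) = u t" "snd (f (w t)) = ellipsoid_accel a (g t) (u t)" if "t \<in> D" for t
    using f[of "g t" "u t"] that by (simp_all add: g_def u_def D_def)
  have openD: "openin (top_of_set {0..}) D"
  proof -
    have "D = {0..} \<inter> (\<lambda>t. (norm (g t), norm (u t), ?A (g t) \<bullet> ?A (g t))) -` ({..<R} \<times> {..<R} \<times> {\<epsilon><..})"
      by (auto simp: D_def)
    then show ?thesis
      using continuous_openin_preimage_gen[of "{0..}" "\<lambda>t. (norm (g t), norm (u t), ?A (g t) \<bullet> ?A (g t))"
          "{..<R} \<times> {..<R} \<times> {\<epsilon><..}"]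
      by (simp add: continuous_intros conts contA open_Times)
  qed
  define P where "P t = unit_tangent a (g t) (u t)" for t
  define Q where "Q t = (?A (g t) \<bullet> g t, ?A (g t) \<bullet> u t, u t \<bullet> u t)" for t
  have PQ: "P t \<longleftrightarrow> Q t = (1, 0, 1)" for t by (auto simp: P_def Q_def unit_tangent_def)
  have "P t" if "t \<ge> 0" for t
  proof (rule connected_induction_simple[of "{0..}" 0 t P])
    show "P 0" using init by (simp add: P_def g_def u_def w0)
    fix s :: real assume s: "s \<in> {0..}"
    show "\<exists>T. openin (top_of_set {0..}) T \<and> s \<in> T \<and> (\<forall>x\<in>T. \<forall>y\<in>T. P x \<longrightarrow> P y)"
    \<comment> \<open>Failure of \<open>P\<close> is open by continuity of \<open>Q\<close>. If
      \<open>P s\<close> holds, the solution stays in \<open>D\<close> near \<open>s\<close>, where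
      the field is the genuine one and conserves the entries of \<open>Q\<close>.\<close>
    proof (cases "P s")
      case False
      have "continuous_on {0..} Q" unfolding Q_def by (intro continuous_intros conts contA)
      then have "openin (top_of_set {0..}) ({0..} \<inter> Q -` (- {(1,0,1)}))"
        by (intro continuous_openin_preimage_gen) auto
      then show ?thesis using False s by (intro exI[of _ "{0..} \<inter> Q -` (- {(1,0,1)})"]) (auto simp: PQ)
    next
      case True
      then have "s \<in> D" using s bd by (auto simp: D_def P_def)
      then obtain \<delta> where \<delta>: "\<delta> > 0" "ball s \<delta> \<inter> {0..} \<subseteq> D"
        using openD unfolding openin_contains_ball by blast
      let ?T = "{0..} \<inter> ball s \<delta>"
      have T: "?T \<subseteq> D" "?T \<subseteq> {0..}" "convex ?T" using \<delta> by (auto intro: convex_Int)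
      have gd: "(g has_vector_derivative u t) (at t within ?T)" if "t \<in> ?T" for t
        using has_vector_derivative_within_subset[OF g' T(2), of t] fD[of t] that T(1) by auto
      have ud: "(u has_vector_derivative ellipsoid_accel a (g t) (u t)) (at t within ?T)" if "t \<in> ?T" for t
        using has_vector_derivative_within_subset[OF u' T(2), of t] fD[of t] that T(1) by auto
      have "P y" if x: "x \<in> ?T" "P x" and y: "y \<in> ?T" for x y
      proof -
        have const: "F t = F x"
          if "\<And>t. t \<in> ?T \<Longrightarrow> (F has_real_derivative 0) (at t within ?T)" "t \<in> ?T" for F :: "real \<Rightarrow> real" and t
          using has_vector_derivative_zero_constant[OF T(3), of F] that x
          unfolding has_real_derivative_iff_has_vector_derivative by metis
        \<comment> \<open>This entry comes first: the acceleration is built to conserve it, and the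
          derivatives of the other two are multiples of it.\<close>
        have gu: "?A (g t) \<bullet> u t = 0" if "t \<in> ?T" for t
        proof -
          have "((\<lambda>t. ?A (g t) \<bullet> u t) has_real_derivative 0) (at t within ?T)" if "t \<in> ?T" for t
          proof -
            have "t \<in> D" using that T by auto
            then have "?A (g t) \<bullet> ?A (g t) > 0" using R by (auto simp: D_def)
            then have "?A (g t) \<bullet> ellipsoid_accel a (g t) (u t) + ?A (u t) \<bullet> u t = 0"
              by (simp add: ellipsoid_accel_def inner_commute)
            then show ?thesis using gd[OF that] ud[OF that]
              by (auto intro!: derivative_eq_intros)
          qed
          from const[OF this \<open>t \<in> ?T\<close>] show ?thesis using x(2) by (simp add: P_def unit_tangent_def)
        qed
        have "((\<lambda>t. ?A (g t) \<bullet> g t) has_real_derivative 0) (at t within ?T)" if "t \<in> ?T" for t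
          using has_real_derivative_inner[OF has_vector_derivative_diag[OF gd[OF that], of "\<lambda>j. 1 / a j"] gd[OF that]] gu[OF that]
          by (simp add: inner_diag_sym[of _ "u t"])
        note c1 = const[OF this y]
        have "((\<lambda>t. u t \<bullet> u t) has_real_derivative 0) (at t within ?T)" if "t \<in> ?T" for t
          using has_real_derivative_inner[OF ud[OF that] ud[OF that]] gu[OF that]
          by (simp add: ellipsoid_accel_def inner_commute)
        note c2 = const[OF this y]
        show "P y" using x(2) gu[OF y] c1 c2 by (simp add: P_def unit_tangent_def)
      qed
      moreover have "openin (top_of_set {0..}) ?T" "s \<in> ?T" using s \<delta> by auto
      ultimately show ?thesis by blast
    qed
  qed (use that in \<open>auto simp: convex_connected\<close>)
  note inv = this
  have D: "t \<in> D" if "t \<ge> 0" for t using inv[OF that] bd that by (auto simp: D_def P_def)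
  show thesis
  proof (rule that[of g u])
    show "g 0 = g0" "u 0 = u0" by (simp_all add: g_def u_def w0)
    show "(g has_vector_derivative u t) (at t within {0..})" if "t \<ge> 0" for t
      using g'[OF that] fD[OF D[OF that]] by simp
    show "(u has_vector_derivative ellipsoid_accel a (g t) (u t)) (at t within {0..})" if "t \<ge> 0" for t
      using u'[OF that] fD[OF D[OF that]] by simp
    show "unit_tangent a (g t) (u t)" if "t \<ge> 0" for t using inv[OF that] by (simp add: P_def)
  qed
qed

section \<open>Arc length and continuation of half-geodesics\<close>

text \<open>\<open>\<tau>\<close> inverts the arc length \<open>\<sigma>\<close>, an antiderivative
  of the speed; the positive lower bound on the speed makes \<open>\<sigma>\<close> injective and
  onto.\<close>

lemma arc_length_reparametrization:
  fixes v :: "real \<Rightarrow> real"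
  assumes cont: "continuous_on {0..} v" and low: "\<And>s. s \<ge> 0 \<Longrightarrow> c \<le> v s" and c: "0 < c"
  obtains \<tau> where "\<tau> 0 = 0" "\<And>t. t \<ge> 0 \<Longrightarrow> \<tau> t \<ge> 0"
    "\<And>t. t \<ge> 0 \<Longrightarrow> (\<tau> has_real_derivative 1 / v (\<tau> t)) (at t)"
    "\<And>s. s \<ge> 0 \<Longrightarrow> \<exists>t\<ge>0. \<tau> t = s"
proof -
  \<comment> \<open>Freezing the speed at \<open>v 0\<close> for negative arguments makes
    \<open>\<sigma>\<close> a bijection of the whole line, so that \<open>\<tau>\<close> has a
    two-sided derivative at 0 too.\<close>
  define V where "V s = v (max 0 s)" for s
  have "continuous_on UNIV V"
    unfolding V_def by (rule continuous_on_compose2[OF cont]) (auto intro!: continuous_intros)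
  then have "isCont V s" for s by (simp add: continuous_on_eq_continuous_at)
  then obtain F where "(F has_vector_derivative V s) (at s)" for s
    using einterval_antiderivative[of "-\<infinity>" "\<infinity>" V] by auto
  then have F: "(F has_real_derivative V s) (at s)" for s
    by (simp add: has_real_derivative_iff_has_vector_derivative)
  define \<sigma> where "\<sigma> s = F s - F 0" for s
  have \<sigma>: "(\<sigma> has_real_derivative V s) (at s)" for s
    unfolding \<sigma>_def using DERIV_diff[OF F DERIV_const] by simp
  have V: "c \<le> V s" for s unfolding V_def by (rule low) simp
  have slope: "\<sigma> s + c * (t - s) \<le> \<sigma> t" if "s \<le> t" for s t
  proof -
    have "\<sigma> s - c * s \<le> \<sigma> t - c * t"
    proof (rule DERIV_nonneg_imp_nondecreasing[OF that])
      fix r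
      show "\<exists>y. ((\<lambda>s. \<sigma> s - c * s) has_real_derivative y) (at r) \<and> 0 \<le> y"
        using V[of r] by (intro exI[of _ "V r - c"]) (auto intro!: derivative_eq_intros \<sigma>)
    qed
    then show ?thesis by (simp add: algebra_simps)
  qed
  have mono: "\<sigma> s < \<sigma> t" if "s < t" for s t
    using slope[of s t] mult_pos_pos[OF c, of "t - s"] that by simp
  then have inj: "inj \<sigma>" by (intro linorder_injI) (auto simp: less_imp_neq)
  have \<sigma>0: "\<sigma> 0 = 0" by (simp add: \<sigma>_def)
  have cont\<sigma>: "isCont \<sigma> s" for s using \<sigma> DERIV_isCont by blast
  have surj: "\<exists>s. \<sigma> s = y" for y
  proof -
    let ?b = "\<bar>y\<bar> / c"
    have b: "- ?b \<le> ?b" "c * ?b = \<bar>y\<bar>" using c by (auto simp: field_simps)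
    have "y \<le> \<sigma> ?b" using slope[of 0 ?b] b c \<sigma>0 by simp
    moreover have "\<sigma> (- ?b) \<le> y" using slope[of "- ?b" 0] b c \<sigma>0 by simp
    ultimately show ?thesis using IVT[of \<sigma> "- ?b" y ?b] b cont\<sigma> by blast
  qed
  define \<tau> where "\<tau> = inv \<sigma>"
  have \<sigma>\<tau>: "\<sigma> (\<tau> t) = t" for t unfolding \<tau>_def using surj by (metis f_inv_into_f rangeI)
  have \<tau>\<sigma>: "\<tau> (\<sigma> s) = s" for s unfolding \<tau>_def using inj by simp
  have cont\<tau>: "isCont \<tau> t" for t
    using isCont_inverse_function[of 1 "\<tau> t" \<tau> \<sigma>] \<tau>\<sigma> \<sigma>\<tau> cont\<sigma> by simp
  have nonneg: "\<tau> t \<ge> 0" if "t \<ge> 0" for t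
    using mono[of "\<tau> t" 0] that \<sigma>\<tau> \<sigma>0 by force
  show thesis
  proof
    show "\<tau> 0 = 0" using \<tau>\<sigma>[of 0] \<sigma>0 by simp
    show "\<tau> t \<ge> 0" if "t \<ge> 0" for t using nonneg[OF that] .
    show "(\<tau> has_real_derivative 1 / v (\<tau> t)) (at t)" if "t \<ge> 0" for t
    proof -
      have "V (\<tau> t) = v (\<tau> t)" using nonneg[OF that] by (simp add: V_def)
      moreover have "(\<tau> has_real_derivative inverse (V (\<tau> t))) (at t)"
        by (rule DERIV_inverse_function[OF \<sigma>, where a = "t - 1" and b = "t + 1"])
           (use V[of "\<tau> t"] c \<sigma>\<tau> cont\<tau> in auto)
      ultimately show ?thesis by (simp add: inverse_eq_divide)
    qed
    show "\<exists>t\<ge>0. \<tau> t = s" if "s \<ge> 0" for s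
    proof (intro exI conjI)
      have "0 \<le> c * s" using c that by simp
      then show "0 \<le> \<sigma> s" using slope[OF that] \<sigma>0 by simp
    qed (rule \<tau>\<sigma>)
  qed
qed

text \<open>For \<open>t >= 0\<close> take the given curve in arc length; for \<open>t < 0\<close>
  run backwards the geodesic that starts at \<open>g 0\<close> with velocity \<open>- u 0\<close>.
  The accelerations match at 0 because \<open>ellipsoid_accel\<close> is even in the
  velocity.\<close>

lemma ellipsoid_geodesic_extension:
  fixes a :: "'n::finite \<Rightarrow> real" and g u :: "real \<Rightarrow> real ^ 'n"
  assumes pos: "\<And>j. 0 < a j"
    and v: "continuous_on {0..} v" "\<And>s. s \<ge> 0 \<Longrightarrow> c \<le> v s" "0 < c"
    and g: "\<And>s. s \<ge> 0 \<Longrightarrow> (g has_vector_derivative v s *\<^sub>R u s) (at s within {0..})"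
    and u: "\<And>s. s \<ge> 0 \<Longrightarrow> (u has_vector_derivative v s *\<^sub>R ellipsoid_accel a (g s) (u s)) (at s within {0..})"
    and ut: "\<And>s. s \<ge> 0 \<Longrightarrow> unit_tangent a (g s) (u s)"
  obtains \<Gamma> W where "\<And>t. (\<Gamma> has_vector_derivative W t) (at t)"
    "\<And>t. (W has_vector_derivative ellipsoid_accel a (\<Gamma> t) (W t)) (at t)"
    "\<And>t. unit_tangent a (\<Gamma> t) (W t)" "\<And>s. s \<ge> 0 \<Longrightarrow> g s \<in> range \<Gamma>"
proof -
  obtain \<tau> where \<tau>: "\<tau> 0 = 0" "\<And>t. t \<ge> 0 \<Longrightarrow> \<tau> t \<ge> 0"
    "\<And>t. t \<ge> 0 \<Longrightarrow> (\<tau> has_real_derivative 1 / v (\<tau> t)) (at t)"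
    "\<And>s. s \<ge> 0 \<Longrightarrow> \<exists>t\<ge>0. \<tau> t = s"
    by (rule arc_length_reparametrization[OF v]) (assumption, rule that)
  have comp: "((\<lambda>t. h (\<tau> t)) has_vector_derivative h') (at t within {0..})"
    if t: "t \<ge> 0" and h: "(h has_vector_derivative v (\<tau> t) *\<^sub>R h') (at (\<tau> t) within {0..})"
    for h :: "real \<Rightarrow> real ^ 'n" and h' t
  proof -
    have 1: "(\<tau> has_vector_derivative 1 / v (\<tau> t)) (at t within {0..})"
      using \<tau>(3)[OF t] by (simp add: has_real_derivative_iff_has_vector_derivative has_vector_derivative_at_within)
    have "\<tau> ` {0..} \<subseteq> {0..}" using \<tau>(2) by auto
    then have "(h has_vector_derivative v (\<tau> t) *\<^sub>R h') (at (\<tau> t) within \<tau> ` {0..})"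
      by (rule has_vector_derivative_within_subset[OF h])
    from vector_diff_chain_within[OF 1 this] show ?thesis
      using v(2)[OF \<tau>(2)[OF t]] v(3) by (simp add: o_def)
  qed
  have init: "unit_tangent a (g 0) (- u 0)" using ut[of 0] by (simp add: unit_tangent_def)
  obtain g1 u1 where g1: "g1 0 = g 0" "u1 0 = - u 0"
    "\<And>t. t \<ge> 0 \<Longrightarrow> (g1 has_vector_derivative u1 t) (at t within {0..})"
    "\<And>t. t \<ge> 0 \<Longrightarrow> (u1 has_vector_derivative ellipsoid_accel a (g1 t) (u1 t)) (at t within {0..})"
    "\<And>t. t \<ge> 0 \<Longrightarrow> unit_tangent a (g1 t) (u1 t)"
    by (rule ellipsoid_geodesic_half_line[of a, OF pos init]) (rule that)
  have refl: "((\<lambda>t. h (- t)) has_vector_derivative - h') (at t within {..0})"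
    if "(h has_vector_derivative h') (at (- t) within {0..})"
    for h :: "real \<Rightarrow> real ^ 'n" and h' t
  proof -
    have 1: "((\<lambda>t::real. - t) has_vector_derivative - 1) (at t within {..0})"
      by (auto intro!: derivative_eq_intros)
    have "uminus ` {..0} = {0::real..}" by auto
    with that have "(h has_vector_derivative h') (at (- t) within uminus ` {..0})" by simp
    from vector_diff_chain_within[OF 1 this] show ?thesis by (simp add: o_def)
  qed
  have accel_minus: "ellipsoid_accel a p (- q) = ellipsoid_accel a p q" for p q
    by (simp add: ellipsoid_accel_def)
  define \<Gamma> where "\<Gamma> t = (if t \<in> {0..} then g (\<tau> t) else g1 (- t))" for t
  define W where "W t = (if t \<in> {0..} then u (\<tau> t) else - u1 (- t))" for t
  have U: "UNIV = {0..} \<union> {..<0::real}" by auto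
  \<comment> \<open>The gluing rule asks for derivatives of each branch on its set enlarged by the
    common boundary point 0.\<close>
  have cl: "{0..} \<union> {0..} \<inter> {..0} = {0::real..}" "{..<0} \<union> {0..} \<inter> {..0} = {..0::real}" by auto
  have glue: "((\<lambda>t. if t \<in> {0..} then h (\<tau> t) else k t) has_vector_derivative
      (if t \<in> {0..} then h' t else k' t)) (at t)"
    if "\<And>t. t \<ge> 0 \<Longrightarrow> ((\<lambda>t. h (\<tau> t)) has_vector_derivative h' t) (at t within {0..})"
      "\<And>t. t \<le> 0 \<Longrightarrow> (k has_vector_derivative k' t) (at t within {..0})" "h (\<tau> 0) = k 0" "h' 0 = k' 0"
    for h k h' k' :: "real \<Rightarrow> real ^ 'n" and t
  proof (rule has_vector_derivative_If_within_closures[OF _ U])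
    show "t \<in> {0..} \<union> {..<0}" by auto
  qed (use that in \<open>auto simp: cl\<close>)
  show thesis
  proof
    fix t
    have "(\<Gamma> has_vector_derivative (if t \<in> {0..} then u (\<tau> t) else - u1 (- t))) (at t)"
      unfolding \<Gamma>_def
    proof (rule glue[of g "\<lambda>t. u (\<tau> t)" "\<lambda>t. g1 (- t)" "\<lambda>t. - u1 (- t)"])
      show "((\<lambda>t. g (\<tau> t)) has_vector_derivative u (\<tau> t)) (at t within {0..})" if "t \<ge> 0" for t
        using comp[OF that g[OF \<tau>(2)[OF that]]] .
      show "((\<lambda>t. g1 (- t)) has_vector_derivative - u1 (- t)) (at t within {..0})" if "t \<le> 0" for t
        using refl[OF g1(3)[of "- t"]] that by simp
    qed (simp_all add: \<tau>(1) g1)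
    then show "(\<Gamma> has_vector_derivative W t) (at t)" by (simp add: W_def)
    have "(W has_vector_derivative (if t \<in> {0..} then ellipsoid_accel a (g (\<tau> t)) (u (\<tau> t))
        else ellipsoid_accel a (g1 (- t)) (u1 (- t)))) (at t)"
      unfolding W_def
    proof (rule glue[of u "\<lambda>t. ellipsoid_accel a (g (\<tau> t)) (u (\<tau> t))" "\<lambda>t. - u1 (- t)"
          "\<lambda>t. ellipsoid_accel a (g1 (- t)) (u1 (- t))"])
      show "((\<lambda>t. u (\<tau> t)) has_vector_derivative ellipsoid_accel a (g (\<tau> t)) (u (\<tau> t))) (at t within {0..})"
        if "t \<ge> 0" for t using comp[OF that u[OF \<tau>(2)[OF that]]] .
      show "((\<lambda>t. - u1 (- t)) has_vector_derivative ellipsoid_accel a (g1 (- t)) (u1 (- t))) (at t within {..0})"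
        if "t \<le> 0" for t
        using has_vector_derivative_minus[OF refl[OF g1(4)[of "- t"]]] that by simp
    qed (simp_all add: \<tau>(1) g1 accel_minus)
    then show "(W has_vector_derivative ellipsoid_accel a (\<Gamma> t) (W t)) (at t)"
      by (simp add: W_def \<Gamma>_def accel_minus split: if_splits)
    show "unit_tangent a (\<Gamma> t) (W t)"
    proof (cases "t \<ge> 0")
      case True
      then show ?thesis using ut[OF \<tau>(2)[OF True]] by (simp add: \<Gamma>_def W_def)
    next
      case False
      then show ?thesis using g1(5)[of "- t"] by (simp add: \<Gamma>_def W_def unit_tangent_def)
    qed
  next
    fix s :: real assume "s \<ge> 0"
    then obtain t where "t \<ge> 0" "\<tau> t = s" using \<tau>(4) by blast
    then have "g s = \<Gamma> t" by (simp add: \<Gamma>_def)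
    then show "g s \<in> range \<Gamma>" by blast
  qed
qed

section \<open>Geodesics of the hyperboloid\<close>

lemma inner_diag_self_pos:
  assumes "\<And>j. 0 < f j" "v \<noteq> 0" shows "0 < diag f v \<bullet> v"
proof -
  obtain i where "v $ i \<noteq> 0" using assms(2) by (auto simp: vec_eq_iff)
  then show ?thesis unfolding inner_diag_self
    by (intro sum_pos2[of _ i]) (auto simp: assms less_imp_le)
qed

lemma real_IVT_zero:
  assumes "continuous_on UNIV (f :: real \<Rightarrow> real)" "f s < 0" "0 < f t"
  shows "\<exists>r. f r = 0"
proof -
  have "connected (range f)" using assms(1) connected_continuous_image connected_UNIV by blast
  then have "0 \<in> range f" using assms(2,3) connectedD_interval[of "range f" "f s" "f t" 0] by auto
  then show ?thesis by auto
qed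

lemma DERIV_reverse:
  fixes f :: "real \<Rightarrow> 'b::real_normed_vector"
  assumes "\<And>s. (f has_vector_derivative f' s) (at s)"
  shows "((\<lambda>s. f (- s)) has_vector_derivative - f' (- s)) (at s)"
proof -
  have "((\<lambda>s::real. - s) has_vector_derivative - 1) (at s)" by (auto intro!: derivative_eq_intros)
  from vector_diff_chain_at[OF this assms[of "- s"]] show ?thesis by (simp add: o_def)
qed

lemma DERIV_reverse_real:
  fixes f :: "real \<Rightarrow> real"
  assumes "\<And>s. (f has_real_derivative f' s) (at s)"
  shows "((\<lambda>s. f (- s)) has_real_derivative - f' (- s)) (at s)"
  using DERIV_reverse[of f f' s] assms by (simp add: has_real_derivative_iff_has_vector_derivative)

text \<open>\<open>\<mu>\<close> is the Lagrange multiplier: the acceleration is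
  \<open>- \<mu>\<close> times the normal \<open>(- x0 / \<alpha>, A \<xi>)\<close>. The assumption
  \<open>tangent\<close> is the derivative of \<open>on_surface\<close>, and
  \<open>multiplier\<close> is the derivative of \<open>tangent\<close>.\<close>

locale hyperboloid_geodesic =
  fixes \<alpha> :: real and a :: "'n::finite \<Rightarrow> real"
    and x0 y0 :: "real \<Rightarrow> real" and \<xi> \<eta> :: "real \<Rightarrow> real ^ 'n" and \<mu> :: "real \<Rightarrow> real"
  assumes \<alpha>_pos: "0 < \<alpha>" and a_pos: "0 < a j"
    and DERIV_x0: "(x0 has_real_derivative y0 s) (at s)"
    and DERIV_\<xi>: "(\<xi> has_vector_derivative \<eta> s) (at s)"
    and DERIV_y0: "(y0 has_real_derivative \<mu> s / \<alpha> * x0 s) (at s)"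
    and DERIV_\<eta>: "(\<eta> has_vector_derivative - \<mu> s *\<^sub>R diag (\<lambda>j. 1 / a j) (\<xi> s)) (at s)"
    and on_surface: "diag (\<lambda>j. 1 / a j) (\<xi> s) \<bullet> \<xi> s = 1 + (x0 s)\<^sup>2 / \<alpha>"
    and tangent: "diag (\<lambda>j. 1 / a j) (\<xi> s) \<bullet> \<eta> s = x0 s * y0 s / \<alpha>"
    and unit_speed: "(y0 s)\<^sup>2 + \<eta> s \<bullet> \<eta> s = 1"
    and multiplier: "\<mu> s * (diag (\<lambda>j. 1 / a j) (\<xi> s) \<bullet> diag (\<lambda>j. 1 / a j) (\<xi> s) + (x0 s)\<^sup>2 / \<alpha>\<^sup>2)
      = diag (\<lambda>j. 1 / a j) (\<eta> s) \<bullet> \<eta> s - (y0 s)\<^sup>2 / \<alpha>"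
begin

abbreviation A :: "real ^ 'n \<Rightarrow> real ^ 'n" where "A \<equiv> diag (\<lambda>j. 1 / a j)"
abbreviation B :: "real ^ 'n \<Rightarrow> real ^ 'n" where "B \<equiv> diag (\<lambda>j. 1 / (a j + \<alpha>))"

lemma a_\<alpha>_pos: "0 < a j + \<alpha>" using a_pos[of j] \<alpha>_pos by simp

text \<open>The resolvent identity \<open>A - B = \<alpha> A B\<close>, which links the neck to the
  focal ellipsoid.\<close>

lemma B_add_AB: "B v + \<alpha> *\<^sub>R A (B v) = A v"
proof -
  have "1 / (a j + \<alpha>) * z + \<alpha> * (1 / a j * (1 / (a j + \<alpha>) * z)) = 1 / a j * z" for j z
    using a_pos[of j] a_\<alpha>_pos[of j] by (simp add: divide_simps) algebra
  then show ?thesis by (simp add: vec_eq_iff)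
qed

lemma B_add_BA: "B v + \<alpha> *\<^sub>R B (A v) = A v"
  using B_add_AB[of v] unfolding diag_commute[of "\<lambda>j. 1 / (a j + \<alpha>)"] .

definition M :: real where "M = Max (range a)"
definition c :: real where "c = Max (range (\<lambda>j. 1 / a j))"

lemma a_le_M: "a j \<le> M" unfolding M_def by (intro Max_ge) auto
lemma inverse_a_le_c: "1 / a j \<le> c" unfolding c_def by (intro Max_ge) auto
lemma M_pos: "0 < M" using a_pos[of undefined] a_le_M[of undefined] by linarith
lemma c_pos: "0 < c"
  by (rule less_le_trans[OF _ inverse_a_le_c[of undefined]]) (simp add: a_pos)
lemma inverse_M_le: "1 / M \<le> 1 / a j" using a_le_M[of j] a_pos[of j] by (simp add: frac_le)

section \<open>The first integral and its values on the neck\<close>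

definition F :: real where "F = (y0 0)\<^sup>2 - B (x0 0 *\<^sub>R \<eta> 0 - y0 0 *\<^sub>R \<xi> 0) \<bullet> (x0 0 *\<^sub>R \<eta> 0 - y0 0 *\<^sub>R \<xi> 0)"

definition w :: "real \<Rightarrow> real ^ 'n" where "w s = x0 s *\<^sub>R \<eta> s - y0 s *\<^sub>R \<xi> s"

lemma DERIV_w: "(w has_vector_derivative - (\<mu> s * x0 s / \<alpha>) *\<^sub>R (\<xi> s + \<alpha> *\<^sub>R A (\<xi> s))) (at s)"
proof -
  have "x0 s *\<^sub>R (- \<mu> s *\<^sub>R A (\<xi> s)) + y0 s *\<^sub>R \<eta> s - (y0 s *\<^sub>R \<eta> s + (\<mu> s / \<alpha> * x0 s) *\<^sub>R \<xi> s) =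
      - (\<mu> s * x0 s / \<alpha>) *\<^sub>R (\<xi> s + \<alpha> *\<^sub>R A (\<xi> s))"
    using \<alpha>_pos by (simp add: vec_eq_iff field_simps)
  then show ?thesis
    unfolding w_def
    using has_vector_derivative_diff[OF has_vector_derivative_scaleR[OF DERIV_x0 DERIV_\<eta>]
        has_vector_derivative_scaleR[OF DERIV_y0 DERIV_\<xi>], of s] by simp
qed

text \<open>\<open>w'\<close> is a multiple of \<open>\<xi> + \<alpha> A \<xi>\<close>, which
  \<open>B\<close> maps to \<open>A \<xi>\<close>, and \<open>A \<xi> . w = - y0\<close>. Hence both
  terms have the derivative \<open>2 \<mu> x0 y0 / \<alpha>\<close>.\<close>

lemma F_eq: "(y0 s)\<^sup>2 - B (w s) \<bullet> w s = F"
proof -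
  have "((\<lambda>s. (y0 s)\<^sup>2 - B (w s) \<bullet> w s) has_real_derivative 0) (at s)" for s
  proof -
    have w: "A (\<xi> s) \<bullet> w s = - y0 s"
      by (simp add: w_def inner_simps on_surface tangent power2_eq_square algebra_simps)
    have "B (\<xi> s + \<alpha> *\<^sub>R A (\<xi> s)) = A (\<xi> s)" using B_add_BA[of "\<xi> s"] by simp
    then have eq: "B (w s) \<bullet> (- (\<mu> s * x0 s / \<alpha>) *\<^sub>R (\<xi> s + \<alpha> *\<^sub>R A (\<xi> s))) +
       B (- (\<mu> s * x0 s / \<alpha>) *\<^sub>R (\<xi> s + \<alpha> *\<^sub>R A (\<xi> s))) \<bullet> w s = 2 * (\<mu> s * x0 s / \<alpha>) * y0 s"
      using w by (simp only: inner_diag_sym[of _ "w s"] linear_cmul[OF linear_diag] inner_scaleR_left)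
    have "((\<lambda>s. B (w s) \<bullet> w s) has_real_derivative 2 * (\<mu> s * x0 s / \<alpha>) * y0 s) (at s)"
      using has_real_derivative_inner[OF has_vector_derivative_diag[OF DERIV_w] DERIV_w, of "\<lambda>j. 1 / (a j + \<alpha>)" s]
      unfolding eq .
    moreover have "((\<lambda>s. (y0 s)\<^sup>2) has_real_derivative 2 * (\<mu> s * x0 s / \<alpha>) * y0 s) (at s)"
      by (auto intro!: derivative_eq_intros DERIV_y0)
    ultimately show ?thesis using DERIV_diff by fastforce
  qed
  then have "(y0 s)\<^sup>2 - B (w s) \<bullet> w s = (y0 0)\<^sup>2 - B (w 0) \<bullet> w 0"
    using DERIV_isconst_all by blast
  then show ?thesis by (simp add: F_def w_def)
qed

lemma B_le_A: "B v \<bullet> v \<le> A v \<bullet> v"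
  using a_pos \<alpha>_pos by (intro inner_diag_self_mono) (simp add: frac_le less_imp_le)

lemma B_nonneg: "0 \<le> B v \<bullet> v"
  using a_\<alpha>_pos by (intro inner_diag_self_nonneg) (simp add: less_imp_le)

lemma A_nonneg: "0 \<le> A v \<bullet> v"
  using a_pos by (intro inner_diag_self_nonneg) (simp add: less_imp_le)

text \<open>The bracket is the right-hand side of \<open>multiplier\<close>; this ties
  \<open>x0''\<close> to \<open>F\<close> once \<open>B\<close> is compared with
  \<open>A\<close>.\<close>

lemma A_w: "A (w s) \<bullet> w s = (y0 s)\<^sup>2 + (x0 s)\<^sup>2 * (A (\<eta> s) \<bullet> \<eta> s - (y0 s)\<^sup>2 / \<alpha>)"
proof -
  have "A (w s) \<bullet> w s = (x0 s)\<^sup>2 * (A (\<eta> s) \<bullet> \<eta> s) - 2 * x0 s * y0 s * (A (\<xi> s) \<bullet> \<eta> s) + (y0 s)\<^sup>2 * (A (\<xi> s) \<bullet> \<xi> s)"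
    by (simp add: w_def inner_simps inner_diag_sym[of _ "\<eta> s" "\<xi> s"] power2_eq_square algebra_simps)
  then show ?thesis unfolding on_surface tangent by (simp add: power2_eq_square algebra_simps)
qed

lemma F_le: "F \<le> (y0 s)\<^sup>2"
  using F_eq[of s] B_nonneg[of "w s"] by linarith

lemma continuous_x0: "continuous_on S x0"
  by (rule DERIV_continuous_on[OF has_field_derivative_at_within[OF DERIV_x0]])

lemma continuous_y0: "continuous_on S y0"
  by (rule DERIV_continuous_on[OF has_field_derivative_at_within[OF DERIV_y0]])

text \<open>The normal does not degenerate: \<open>A \<xi> . \<xi> >= 1\<close> bounds its square
  below by \<open>1 / M\<close>, while unit speed bounds the numerator.\<close>

lemma multiplier_bounded: "\<exists>K. \<forall>s. \<bar>\<mu> s / \<alpha>\<bar> \<le> K"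
proof (intro exI allI)
  fix s
  let ?D = "A (\<xi> s) \<bullet> A (\<xi> s) + (x0 s)\<^sup>2 / \<alpha>\<^sup>2"
  have "1 / M \<le> 1 / M * (A (\<xi> s) \<bullet> \<xi> s)"
    unfolding on_surface using M_pos \<alpha>_pos by (simp add: field_simps)
  also have "\<dots> \<le> A (\<xi> s) \<bullet> A (\<xi> s)"
    using a_pos by (intro inner_diag_diag_self_ge inverse_M_le) (simp add: less_imp_le)
  also have "\<dots> \<le> ?D" by simp
  finally have D: "1 / M \<le> ?D" .
  have y: "0 \<le> (y0 s)\<^sup>2" "(y0 s)\<^sup>2 \<le> 1" "\<eta> s \<bullet> \<eta> s \<le> 1"
    using unit_speed[of s] inner_ge_zero[of "\<eta> s"] zero_le_power2[of "y0 s"] by linarith+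
  have "A (\<eta> s) \<bullet> \<eta> s \<le> c * (\<eta> s \<bullet> \<eta> s)" by (intro inner_diag_self_le inverse_a_le_c)
  also have "\<dots> \<le> c * 1" using y c_pos by (intro mult_left_mono) auto
  finally have "A (\<eta> s) \<bullet> \<eta> s \<le> c" by simp
  moreover have "(y0 s)\<^sup>2 / \<alpha> \<le> 1 / \<alpha>" "0 \<le> (y0 s)\<^sup>2 / \<alpha>" "0 < 1 / \<alpha>" using y \<alpha>_pos by (auto simp: divide_right_mono)
  ultimately have N: "\<bar>\<mu> s * ?D\<bar> \<le> c + 1 / \<alpha>"
    unfolding multiplier using A_nonneg[of "\<eta> s"] c_pos by linarith
  have "\<bar>\<mu> s\<bar> * (1 / M) \<le> \<bar>\<mu> s\<bar> * ?D" using D by (intro mult_left_mono) auto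
  also have "\<dots> = \<bar>\<mu> s * ?D\<bar>" using D M_pos by (simp add: abs_mult)
  finally have "\<bar>\<mu> s\<bar> * (1 / M) \<le> c + 1 / \<alpha>" using N by linarith
  then show "\<bar>\<mu> s / \<alpha>\<bar> \<le> (c + 1 / \<alpha>) * M / \<alpha>"
    using M_pos \<alpha>_pos by (simp add: field_simps)
qed

text \<open>A geodesic tangent to the neck stays on it, by uniqueness for the linear equation
  \<open>x0'' = (\<mu> / \<alpha>) x0\<close> with \<open>\<mu>\<close> regarded as a given
  coefficient.\<close>

lemma vanishes:
  assumes "x0 s0 = 0" "y0 s0 = 0" shows "x0 s = 0"
proof -
  obtain K where "\<And>s. \<bar>\<mu> s / \<alpha>\<bar> \<le> K" using multiplier_bounded by blast
  then show ?thesis by (rule linear_ode_zero[OF DERIV_x0 DERIV_y0 _ assms])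
qed

text \<open>On the neck \<open>w = - y0 \<xi>\<close>, so \<open>F\<close> has the factor
  \<open>1 - B \<xi> . \<xi>\<close>, which is positive because \<open>A - B = \<alpha> A B\<close>
  is positive definite.\<close>

lemma F_at_neck:
  assumes "x0 s = 0" shows "0 \<le> F" "F = 0 \<Longrightarrow> y0 s = 0"
proof -
  have x: "A (\<xi> s) \<bullet> \<xi> s = 1" using on_surface[of s] assms by simp
  have "0 < A (B (\<xi> s)) \<bullet> \<xi> s"
  proof -
    have "\<xi> s \<noteq> 0" using x by auto
    then have "0 < diag (\<lambda>j. 1 / a j * (1 / (a j + \<alpha>))) (\<xi> s) \<bullet> \<xi> s"
      using a_pos a_\<alpha>_pos by (intro inner_diag_self_pos) auto
    moreover have "diag (\<lambda>j. 1 / a j * (1 / (a j + \<alpha>))) (\<xi> s) = A (B (\<xi> s))"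
      by (simp add: vec_eq_iff)
    ultimately show ?thesis by simp
  qed
  then have less: "B (\<xi> s) \<bullet> \<xi> s < 1"
    using arg_cong[OF B_add_AB[of "\<xi> s"], of "\<lambda>v. v \<bullet> \<xi> s"] x mult_pos_pos[OF \<alpha>_pos, of "A (B (\<xi> s)) \<bullet> \<xi> s"]
    unfolding inner_add_left inner_scaleR_left by linarith
  have F: "F = (y0 s)\<^sup>2 * (1 - B (\<xi> s) \<bullet> \<xi> s)"
    unfolding F_eq[of s, symmetric] by (simp add: w_def assms power2_eq_square algebra_simps)
  show "0 \<le> F" unfolding F using less by simp
  show "F = 0 \<Longrightarrow> y0 s = 0" unfolding F using less by simp
qed

section \<open>Crossing, symmetries and reflection\<close>

lemma crosses_iff: "(\<exists>s t. x0 s < 0 \<and> 0 < x0 t) \<longleftrightarrow> 0 < F"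
proof
  assume "\<exists>s t. x0 s < 0 \<and> 0 < x0 t"
  then obtain s t where st: "x0 s < 0" "0 < x0 t" by blast
  then obtain r where r: "x0 r = 0" using real_IVT_zero[OF continuous_x0] by blast
  show "0 < F"
  proof (rule ccontr)
    assume "\<not> 0 < F"
    then have "y0 r = 0" using F_at_neck[OF r] by linarith
    then show False using vanishes[OF r] st by simp
  qed
next
  assume F: "0 < F"
  have lower: "sqrt F \<le> \<bar>y0 s\<bar>" for s using real_sqrt_le_mono[OF F_le[of s]] by simp
  have nz: "y0 s \<noteq> 0" for s using F_le[of s] F by auto
  have "(\<forall>s. y0 s > 0) \<or> (\<forall>s. y0 s < 0)"
    using real_IVT_zero[OF continuous_y0] nz by (metis linorder_neqE_linordered_idom)
  then show "\<exists>s t. x0 s < 0 \<and> 0 < x0 t"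
  proof
    assume pos: "\<forall>s. y0 s > 0"
    have incr: "x0 s - sqrt F * s \<le> x0 t - sqrt F * t" if "s \<le> t" for s t
    proof (rule DERIV_nonneg_imp_nondecreasing[OF that])
      fix r
      show "\<exists>y. ((\<lambda>s. x0 s - sqrt F * s) has_real_derivative y) (at r) \<and> 0 \<le> y"
        using lower[of r] pos[rule_format, of r]
        by (intro exI[of _ "y0 r - sqrt F"]) (auto intro!: derivative_eq_intros DERIV_x0)
    qed
    have q: "sqrt F > 0" using F by simp
    \<comment> \<open>At a rate of at least \<open>sqrt F\<close>, the time
      \<open>(\<bar>x0 0\<bar> + 1) / sqrt F\<close> suffices to change \<open>x0\<close> by more
      than \<open>\<bar>x0 0\<bar>\<close>.\<close>
    have "x0 (- (\<bar>x0 0\<bar> + 1) / sqrt F) < 0" "0 < x0 ((\<bar>x0 0\<bar> + 1) / sqrt F)"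
      using incr[of "- (\<bar>x0 0\<bar> + 1) / sqrt F" 0] incr[of 0 "(\<bar>x0 0\<bar> + 1) / sqrt F"] q
      by (auto simp: divide_nonpos_pos divide_nonneg_pos)
    then show ?thesis by blast
  next
    assume neg: "\<forall>s. y0 s < 0"
    have decr: "x0 t + sqrt F * t \<le> x0 s + sqrt F * s" if "s \<le> t" for s t
    proof (rule DERIV_nonpos_imp_nonincreasing[OF that])
      fix r
      show "\<exists>y. ((\<lambda>s. x0 s + sqrt F * s) has_real_derivative y) (at r) \<and> y \<le> 0"
        using lower[of r] neg[rule_format, of r]
        by (intro exI[of _ "y0 r + sqrt F"]) (auto intro!: derivative_eq_intros DERIV_x0)
    qed
    have q: "sqrt F > 0" using F by simp
    have "0 < x0 (- (\<bar>x0 0\<bar> + 1) / sqrt F)" "x0 ((\<bar>x0 0\<bar> + 1) / sqrt F) < 0"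
      using decr[of "- (\<bar>x0 0\<bar> + 1) / sqrt F" 0] decr[of 0 "(\<bar>x0 0\<bar> + 1) / sqrt F"] q
      by (auto simp: divide_nonpos_pos divide_nonneg_pos)
    then show ?thesis by blast
  qed
qed

text \<open>With time reversal, this reduces geodesics that avoid the neck to \<open>x0 > 0\<close>,
  and in the separatrix case also to \<open>y0 < 0\<close>.\<close>

lemma negate: "hyperboloid_geodesic \<alpha> a (\<lambda>s. - x0 s) (\<lambda>s. - y0 s) \<xi> \<eta> \<mu>"
proof
  fix s
  show "((\<lambda>s. - y0 s) has_real_derivative \<mu> s / \<alpha> * - x0 s) (at s)"
    by (auto intro!: derivative_eq_intros DERIV_y0)
qed (simp_all add: \<alpha>_pos a_pos DERIV_x0 DERIV_\<xi> DERIV_\<eta> on_surface tangent unit_speed multiplier DERIV_minus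
       del: mult_minus_left scaleR_minus_left)

lemma reverse:
  "hyperboloid_geodesic \<alpha> a (\<lambda>s. x0 (- s)) (\<lambda>s. - y0 (- s)) (\<lambda>s. \<xi> (- s)) (\<lambda>s. - \<eta> (- s)) (\<lambda>s. \<mu> (- s))"
proof
  fix s
  show "((\<lambda>s. - y0 (- s)) has_real_derivative \<mu> (- s) / \<alpha> * x0 (- s)) (at s)"
    using DERIV_minus[OF DERIV_reverse_real[OF DERIV_y0, of s]] by simp
  show "((\<lambda>s. - \<eta> (- s)) has_vector_derivative - \<mu> (- s) *\<^sub>R A (\<xi> (- s))) (at s)"
    using has_vector_derivative_minus[OF DERIV_reverse[OF DERIV_\<eta>, of s]] by simp
qed (simp_all add: \<alpha>_pos a_pos DERIV_reverse_real[OF DERIV_x0] DERIV_reverse[OF DERIV_\<xi>]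
       on_surface tangent unit_speed multiplier)

lemma escapes_of_pos:
  assumes F: "F < 0" and pos: "\<And>s. 0 < x0 s"
  shows "filterlim x0 at_top at_top"
proof (rule convex_filterlim_at_top[OF DERIV_x0 DERIV_y0 pos])
  \<comment> \<open>\<open>C\<close> absorbs the growth of the squared normal:
    \<open>?D <= C * (1 + x0^2)\<close> below.\<close>
  define C where "C = c + c / \<alpha> + 1 / \<alpha>\<^sup>2"
  have C: "C > 0" unfolding C_def using c_pos \<alpha>_pos by (simp add: add_pos_pos)
  show "0 < - F / (C * \<alpha>)" using F C \<alpha>_pos by (simp add: divide_neg_pos)
  fix s
  let ?D = "A (\<xi> s) \<bullet> A (\<xi> s) + (x0 s)\<^sup>2 / \<alpha>\<^sup>2"
  \<comment> \<open>Here \<open>B <= A\<close> enters: \<open>- F = B w . w - y0^2\<close> is at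
    most \<open>A w . w - y0^2\<close>, which is the right-hand side.\<close>
  have "- F \<le> (x0 s)\<^sup>2 * (\<mu> s * ?D)"
    using A_w[of s] F_eq[of s] B_le_A[of "w s"] unfolding multiplier by linarith
  then have 1: "- F \<le> (x0 s)\<^sup>2 * \<mu> s * ?D" by (simp only: mult.assoc)
  have D0: "?D \<ge> 0" by simp
  have "A (\<xi> s) \<bullet> A (\<xi> s) \<le> c * (1 + (x0 s)\<^sup>2 / \<alpha>)"
    unfolding on_surface[symmetric] using a_pos
    by (intro inner_diag_diag_self_le inverse_a_le_c) (simp add: less_imp_le)
  then have "?D \<le> c * (1 + (x0 s)\<^sup>2 / \<alpha>) + (x0 s)\<^sup>2 / \<alpha>\<^sup>2" by simp
  also have "\<dots> \<le> C * (1 + (x0 s)\<^sup>2)"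
    unfolding C_def using c_pos \<alpha>_pos by (simp add: field_simps)
  finally have D: "?D \<le> C * (1 + (x0 s)\<^sup>2)" .
  have "0 < (x0 s)\<^sup>2 * \<mu> s * ?D" using 1 F by linarith
  then have "0 \<le> (x0 s)\<^sup>2 * \<mu> s" using D0 by (simp add: zero_less_mult_iff)
  then have "- F \<le> (x0 s)\<^sup>2 * \<mu> s * (C * (1 + (x0 s)\<^sup>2))"
    using 1 D by (meson mult_left_mono order_trans)
  then have "- F / (C * \<alpha>) \<le> (x0 s)\<^sup>2 * \<mu> s * (C * (1 + (x0 s)\<^sup>2)) / (C * \<alpha>)"
    using C \<alpha>_pos by (intro divide_right_mono) auto
  also have "\<dots> = x0 s * (\<mu> s / \<alpha> * x0 s) * (1 + (x0 s)\<^sup>2)"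
    using C \<alpha>_pos by (simp add: power2_eq_square)
  finally show "- F / (C * \<alpha>) \<le> x0 s * (\<mu> s / \<alpha> * x0 s) * (1 + (x0 s)\<^sup>2)" .
qed

lemma F_negate: "hyperboloid_geodesic.F \<alpha> a (\<lambda>s. - x0 s) (\<lambda>s. - y0 s) \<xi> \<eta> = F"
proof -
  interpret N: hyperboloid_geodesic \<alpha> a "\<lambda>s. - x0 s" "\<lambda>s. - y0 s" \<xi> \<eta> \<mu> by (rule negate)
  have "N.w 0 = - w 0" by (simp add: N.w_def w_def)
  then show ?thesis using N.F_eq[of 0] F_eq[of 0] by simp
qed

lemma F_reverse:
  "hyperboloid_geodesic.F \<alpha> a (\<lambda>s. x0 (- s)) (\<lambda>s. - y0 (- s)) (\<lambda>s. \<xi> (- s)) (\<lambda>s. - \<eta> (- s)) = F"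
proof -
  interpret N: hyperboloid_geodesic \<alpha> a "\<lambda>s. x0 (- s)" "\<lambda>s. - y0 (- s)" "\<lambda>s. \<xi> (- s)" "\<lambda>s. - \<eta> (- s)" "\<lambda>s. \<mu> (- s)"
    by (rule reverse)
  have "N.w 0 = - w 0" by (simp add: N.w_def w_def)
  then show ?thesis using N.F_eq[of 0] F_eq[of 0] by simp
qed

lemma escapes_both_of_pos:
  assumes F: "F < 0" and pos: "\<And>s. 0 < x0 s"
  shows "filterlim x0 at_top at_top \<and> filterlim x0 at_top at_bot"
proof
  show "filterlim x0 at_top at_bot"
    unfolding filterlim_at_bot_mirror
    by (rule hyperboloid_geodesic.escapes_of_pos[OF reverse]) (simp_all add: F_reverse F pos)
qed (rule escapes_of_pos[OF assms])

lemma reflected: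
  assumes F: "F < 0"
  shows "(\<forall>s. x0 s \<noteq> 0) \<and>
    ((filterlim x0 at_top at_top \<and> filterlim x0 at_top at_bot) \<or>
     (filterlim x0 at_bot at_top \<and> filterlim x0 at_bot at_bot))"
proof -
  have nz: "x0 s \<noteq> 0" for s using F_at_neck(1)[of s] F by auto
  then have "(\<forall>s. x0 s > 0) \<or> (\<forall>s. x0 s < 0)"
    using real_IVT_zero[OF continuous_x0] by (metis linorder_neqE_linordered_idom)
  then show ?thesis
  proof
    assume "\<forall>s. x0 s > 0"
    then show ?thesis using escapes_both_of_pos[OF F] nz by blast
  next
    assume "\<forall>s. x0 s < 0"
    then have "filterlim (\<lambda>s. - x0 s) at_top at_top \<and> filterlim (\<lambda>s. - x0 s) at_top at_bot"
      using hyperboloid_geodesic.escapes_both_of_pos[OF negate] F by (simp add: F_negate)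
    then show ?thesis using nz by (simp add: filterlim_uminus_at_bot)
  qed
qed

end

section \<open>The separatrix case\<close>

text \<open>The component along \<open>q\<close> changes only the length, so normalising removes
  it.\<close>

lemma has_vector_derivative_normalize:
  fixes q :: "real \<Rightarrow> 'a::real_inner"
  assumes q: "(q has_vector_derivative c1 *\<^sub>R q s + c2 *\<^sub>R n) (at s)"
    and orth: "q s \<bullet> n = 0" and nz: "q s \<noteq> 0"
  shows "((\<lambda>s. (1 / norm (q s)) *\<^sub>R q s) has_vector_derivative (c2 / norm (q s)) *\<^sub>R n) (at s)"
proof -
  have sq: "((\<lambda>s. q s \<bullet> q s) has_real_derivative 2 * c1 * (q s \<bullet> q s)) (at s)"
    using has_real_derivative_inner[OF q q] orth by (simp add: inner_simps inner_commute mult.assoc)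
  have pos: "q s \<bullet> q s > 0" using nz by simp
  have "((\<lambda>s. sqrt (q s \<bullet> q s)) has_real_derivative c1 * norm (q s)) (at s)"
    by (rule DERIV_cong[OF DERIV_chain2[OF DERIV_real_sqrt[OF pos] sq]])
       (use nz in \<open>simp add: norm_eq_sqrt_inner[symmetric] dot_square_norm power2_eq_square\<close>)
  then have "((\<lambda>s. norm (q s)) has_real_derivative c1 * norm (q s)) (at s)"
    by (simp add: norm_eq_sqrt_inner)
  then have "((\<lambda>s. 1 / norm (q s)) has_real_derivative - (c1 / norm (q s))) (at s)"
    using nz by (auto intro!: derivative_eq_intros)
  from has_vector_derivative_scaleR[OF this q] show ?thesis
    using nz by (simp add: scaleR_add_right)
qed

text \<open>Normal form of the separatrix: the geodesic descends towards the neck from above as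
  \<open>s\<close> grows.\<close>

locale asymptotic_geodesic = hyperboloid_geodesic +
  assumes F_zero: "F = 0" and x0_pos: "0 < x0 s" and y0_neg: "y0 s < 0"
begin

text \<open>\<open>(0, p)\<close> is the intersection of the tangent line at \<open>(x0, \<xi>)\<close> with the hyperplane of the neck. The numbers
  \<open>h\<close>, \<open>b1\<close> and \<open>b2\<close> are the coefficients of the quadratic equation stating that \<open>\<xi> + e *\<^sub>R d\<close> lies on the neck, and
  \<open>e\<close> is its root closer to \<open>0\<close>, written so that \<open>b2 s = 0\<close> is harmless.\<close>

definition r where "r s = - y0 s / x0 s"
definition p where "p s = \<xi> s + (1 / r s) *\<^sub>R \<eta> s"
definition k where "k s = \<mu> s / (\<alpha> * r s)"
text \<open>\<open>\<xi> - d = p - \<alpha> B p\<close> is the pole, with respect to the neck, of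
  the tangent hyperplane of the focal ellipsoid at \<open>p\<close>, since
  \<open>A (p - \<alpha> B p) = B p\<close>.\<close>

definition d where "d s = \<xi> s - p s + \<alpha> *\<^sub>R B (p s)"
definition h where "h s = (x0 s)\<^sup>2 / \<alpha>"
definition b1 where "b1 s = A (\<xi> s) \<bullet> d s"
definition b2 where "b2 s = A (d s) \<bullet> d s"
definition disc where "disc s = (b1 s)\<^sup>2 - h s * b2 s"
definition e where "e s = - h s / (b1 s + sqrt (disc s))"
definition g where "g s = \<xi> s + e s *\<^sub>R d s"

lemma r_pos: "0 < r s"
  unfolding r_def using x0_pos[of s] y0_neg[of s] by (simp add: divide_neg_pos)

lemma y0_eq: "y0 s = - r s * x0 s"
  unfolding r_def using x0_pos[of s] by simp

lemma \<eta>_eq: "\<eta> s = r s *\<^sub>R (p s - \<xi> s)"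
  unfolding p_def using r_pos[of s] by simp

text \<open>This is \<open>F = 0\<close> in disguise: \<open>w = x0 r p\<close> and
  \<open>y0 = - r x0\<close>, and \<open>(x0 r)^2\<close> cancels.\<close>

lemma B_p_p: "B (p s) \<bullet> p s = 1"
proof -
  have "w s = (x0 s * r s) *\<^sub>R p s"
    unfolding w_def \<eta>_eq[of s] y0_eq[of s] by (simp add: scaleR_diff_right)
  then have "(x0 s * r s)\<^sup>2 * (B (p s) \<bullet> p s) = (x0 s * r s)\<^sup>2"
    using F_eq[of s] unfolding F_zero y0_eq[of s] by (simp add: power2_eq_square mult_ac)
  then show ?thesis using r_pos[of s] x0_pos[of s] by simp
qed

text \<open>The tangent hyperplane at \<open>x\<close> consists of the points pairing to 1 with the
  normal \<open>(- x0 / \<alpha>, A \<xi>)\<close>, and \<open>(0, p)\<close> is one of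
  them.\<close>

lemma A_\<xi>_p: "A (\<xi> s) \<bullet> p s = 1"
  unfolding p_def using r_pos[of s] \<alpha>_pos
  by (simp add: inner_simps on_surface tangent y0_eq power2_eq_square)

lemma DERIV_r: "(r has_real_derivative (r s)\<^sup>2 - \<mu> s / \<alpha>) (at s)"
proof -
  have "((\<lambda>s. - y0 s / x0 s) has_real_derivative
      (- (\<mu> s / \<alpha> * x0 s) * x0 s - - y0 s * y0 s) / (x0 s * x0 s)) (at s)"
    using x0_pos[of s] by (intro DERIV_divide DERIV_minus DERIV_y0 DERIV_x0) simp
  moreover have "(- (\<mu> s / \<alpha> * x0 s) * x0 s - - y0 s * y0 s) / (x0 s * x0 s) = (r s)\<^sup>2 - \<mu> s / \<alpha>"
    unfolding r_def using x0_pos[of s] by (simp add: power2_eq_square diff_divide_distrib add_divide_distrib)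
  ultimately show ?thesis unfolding r_def[abs_def] by simp
qed

text \<open>\<open>1 + \<alpha> A\<close> and \<open>1 - \<alpha> B\<close> are inverse to each
  other.\<close>

lemma d_add_Ad: "d s + \<alpha> *\<^sub>R A (d s) = \<xi> s + \<alpha> *\<^sub>R A (\<xi> s) - p s"
proof -
  have "A (p s) = B (p s) + \<alpha> *\<^sub>R A (B (p s))" using B_add_AB[of "p s"] by simp
  then show ?thesis unfolding d_def by (simp add: algebra_simps)
qed

lemma DERIV_p: "(p has_vector_derivative - k s *\<^sub>R (d s + \<alpha> *\<^sub>R A (d s))) (at s)"
proof -
  have inv: "((\<lambda>s. 1 / r s) has_real_derivative - ((r s)\<^sup>2 - \<mu> s / \<alpha>) / (r s)\<^sup>2) (at s)"
    using r_pos[of s] by (auto intro!: derivative_eq_intros DERIV_r simp: power2_eq_square)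
  have coeff: "r s + - ((r s)\<^sup>2 - \<mu> s / \<alpha>) / (r s)\<^sup>2 * r s = k s" "1 / r s * \<mu> s = k s * \<alpha>"
    unfolding k_def using r_pos[of s] \<alpha>_pos by (simp_all add: field_simps power2_eq_square)
  have "\<eta> s + ((1 / r s) *\<^sub>R (- \<mu> s *\<^sub>R A (\<xi> s)) + (- ((r s)\<^sup>2 - \<mu> s / \<alpha>) / (r s)\<^sup>2) *\<^sub>R \<eta> s) =
      (r s + - ((r s)\<^sup>2 - \<mu> s / \<alpha>) / (r s)\<^sup>2 * r s) *\<^sub>R (p s - \<xi> s) - (1 / r s * \<mu> s) *\<^sub>R A (\<xi> s)"
    unfolding \<eta>_eq[of s] by (simp only: scaleR_add_left scaleR_scaleR scaleR_minus_left scaleR_minus_right)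
       (simp only: diff_conv_add_uminus ac_simps)
  also have "\<dots> = - k s *\<^sub>R (d s + \<alpha> *\<^sub>R A (d s))"
    unfolding coeff d_add_Ad by (simp add: scaleR_add_right scaleR_diff_right)
  finally have "\<eta> s + ((1 / r s) *\<^sub>R (- \<mu> s *\<^sub>R A (\<xi> s)) + (- ((r s)\<^sup>2 - \<mu> s / \<alpha>) / (r s)\<^sup>2) *\<^sub>R \<eta> s) =
      - k s *\<^sub>R (d s + \<alpha> *\<^sub>R A (d s))" .
  then show ?thesis
    unfolding p_def[abs_def]
    using has_vector_derivative_add[OF DERIV_\<xi> has_vector_derivative_scaleR[OF inv DERIV_\<eta>]] by simp
qed

text \<open>Applying \<open>1 - \<alpha> B\<close> to \<open>p'\<close> undoes
  \<open>1 + \<alpha> A\<close> and leaves \<open>- k d\<close>.\<close>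

lemma DERIV_d: "(d has_vector_derivative \<eta> s + k s *\<^sub>R d s) (at s)"
proof -
  have "B (d s + \<alpha> *\<^sub>R A (d s)) = A (d s)" using B_add_BA[of "d s"] by simp
  then have eq: "\<eta> s - (- k s *\<^sub>R (d s + \<alpha> *\<^sub>R A (d s))) + \<alpha> *\<^sub>R B (- k s *\<^sub>R (d s + \<alpha> *\<^sub>R A (d s))) =
      \<eta> s + k s *\<^sub>R d s"
    by (simp only: linear_cmul[OF linear_diag]) (simp add: algebra_simps)
  have d': "(d has_vector_derivative Z) (at s)"
    if "((\<lambda>s. \<xi> s - p s + \<alpha> *\<^sub>R B (p s)) has_vector_derivative Z) (at s)" for Z
    using that unfolding d_def[abs_def] .
  have "(d has_vector_derivative
     \<eta> s - (- k s *\<^sub>R (d s + \<alpha> *\<^sub>R A (d s))) + \<alpha> *\<^sub>R B (- k s *\<^sub>R (d s + \<alpha> *\<^sub>R A (d s)))) (at s)"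
    by (rule d') (intro has_vector_derivative_add has_vector_derivative_diff DERIV_\<xi> DERIV_p
        bounded_linear.has_vector_derivative[OF bounded_linear_scaleR_right] has_vector_derivative_diag)
  then show ?thesis unfolding eq .
qed

text \<open>Both \<open>\<xi>\<close> and the pole \<open>\<xi> - d\<close> lie in the polar
  hyperplane of \<open>p\<close> with respect to the neck, hence so does the line through them. This
  makes \<open>p - g\<close> tangent to the neck at \<open>g\<close>.\<close>

lemma A_d_p: "A (d s) \<bullet> p s = 0"
proof -
  have "A (d s) \<bullet> p s = A (\<xi> s) \<bullet> p s - (A (p s) - \<alpha> *\<^sub>R A (B (p s))) \<bullet> p s"
    unfolding d_def by (simp add: inner_simps)
  also have "A (p s) - \<alpha> *\<^sub>R A (B (p s)) = B (p s)" using B_add_AB[of "p s"] by (simp add: algebra_simps)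
  finally show ?thesis by (simp add: A_\<xi>_p B_p_p)
qed

section \<open>The quadratic equation for \<open>g\<close>\<close>

lemma A_quadratic: "A (\<xi> s + t *\<^sub>R d s) \<bullet> (\<xi> s + t *\<^sub>R d s) = 1 + h s + 2 * t * b1 s + t\<^sup>2 * b2 s"
  unfolding h_def b1_def b2_def
  by (simp add: inner_simps on_surface inner_diag_sym[of _ "d s" "\<xi> s"] power2_eq_square algebra_simps)

text \<open>The parameter -1 belongs to the pole, which lies inside the neck, whereas \<xi> at
  parameter 0 lies outside; the line meets the neck in between.\<close>

lemma at_minus_1: "h s - 2 * b1 s + b2 s = - \<alpha> * (B (p s) \<bullet> B (p s))"
proof -
  have d: "\<xi> s + (- 1) *\<^sub>R d s = p s - \<alpha> *\<^sub>R B (p s)" by (simp add: d_def)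
  have A: "A (p s - \<alpha> *\<^sub>R B (p s)) = B (p s)"
    using B_add_AB[of "p s"] by (simp add: algebra_simps)
  have "1 + h s + 2 * (- 1) * b1 s + (- 1)\<^sup>2 * b2 s = B (p s) \<bullet> (p s - \<alpha> *\<^sub>R B (p s))"
    unfolding A_quadratic[symmetric] d A ..
  then show ?thesis by (simp add: inner_diff_right B_p_p)
qed

lemma B_p_ge: "1 / (M + \<alpha>) \<le> B (p s) \<bullet> B (p s)"
proof -
  have "1 / (M + \<alpha>) * (B (p s) \<bullet> p s) \<le> B (p s) \<bullet> B (p s)"
    using a_\<alpha>_pos a_le_M by (intro inner_diag_diag_self_ge frac_le) (auto simp: less_imp_le)
  then show ?thesis by (simp add: B_p_p)
qed

lemma h_pos: "0 < h s" unfolding h_def using x0_pos[of s] \<alpha>_pos by simp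

lemma b2_nonneg: "0 \<le> b2 s" unfolding b2_def by (rule A_nonneg)

text \<open>A bound, uniform in \<open>s\<close>, for how far the form \<open>A\<close> at the pole
  lies below 1.\<close>

definition gap where "gap = \<alpha> / (M + \<alpha>)"

lemma two_b1: "h s + b2 s + gap \<le> 2 * b1 s"
proof -
  have "\<alpha> * (1 / (M + \<alpha>)) \<le> \<alpha> * (B (p s) \<bullet> B (p s))"
    using B_p_ge \<alpha>_pos by (intro mult_left_mono) auto
  then show ?thesis using at_minus_1[of s] by (simp add: gap_def)
qed

lemma gap_pos: "0 < gap"
  unfolding gap_def by (intro divide_pos_pos add_pos_pos \<alpha>_pos M_pos)

lemma b1_pos: "gap \<le> 2 * b1 s" "0 < b1 s" "h s + b2 s < 2 * b1 s"
  using two_b1[of s] h_pos[of s] b2_nonneg[of s] gap_pos by linarith+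

lemma disc_pos: "0 < disc s"
proof -
  have "(h s + b2 s)\<^sup>2 < (2 * b1 s)\<^sup>2"
    using b1_pos(3)[of s] h_pos[of s] b2_nonneg[of s] by (intro power_strict_mono) auto
  moreover have "4 * (h s * b2 s) \<le> (h s + b2 s)\<^sup>2"
    using zero_le_power2[of "h s - b2 s"] by (simp add: power2_sum power2_diff)
  ultimately show ?thesis unfolding disc_def by (simp add: power_mult_distrib)
qed

lemma denom_pos: "0 < b1 s + sqrt (disc s)"
  using b1_pos(2)[of s] disc_pos[of s] by (simp add: add_pos_pos)

lemma e_root: "h s + 2 * e s * b1 s + (e s)\<^sup>2 * b2 s = 0"
proof -
  \<comment> \<open>\<open>t\<close> is a root of the reversed polynomial
    \<open>t^2 - 2 b1 t + h b2\<close>, and \<open>e = - h / t\<close>.\<close>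
  define t where "t = b1 s + sqrt (disc s)"
  have t: "t > 0" "t\<^sup>2 - 2 * b1 s * t + h s * b2 s = 0"
    using denom_pos[of s] disc_pos[of s]
    by (simp_all add: t_def power2_eq_square algebra_simps) (simp add: disc_def power2_eq_square)
  have "t\<^sup>2 * (h s + 2 * e s * b1 s + (e s)\<^sup>2 * b2 s) = h s * (t\<^sup>2 - 2 * b1 s * t + h s * b2 s)"
    unfolding e_def t_def[symmetric] using t(1) by (simp add: field_simps power2_eq_square)
  then show ?thesis using t by simp
qed

text \<open>The root is simple, which permits solving for \<open>e'\<close> by implicit
  differentiation.\<close>

lemma e_derivative_nonzero: "b1 s + e s * b2 s \<noteq> 0"
proof -
  define t where "t = b1 s + sqrt (disc s)"
  have "t > 0" using denom_pos[of s] by (simp add: t_def)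
  then have "(b1 s + e s * b2 s) * t = b1 s * t - h s * b2 s"
    unfolding e_def t_def[symmetric] by (simp add: algebra_simps)
  also have "\<dots> = disc s + b1 s * sqrt (disc s)"
    unfolding t_def by (simp add: disc_def power2_eq_square algebra_simps)
  also have "\<dots> > 0" using disc_pos[of s] b1_pos(2)[of s] by (simp add: add_pos_pos)
  finally show ?thesis by auto
qed

text \<open>\<open>g\<close> stays on the \<xi> side of the pole, so the factor \<open>1 + e\<close>
  of the speed of \<open>g\<close> is positive.\<close>

lemma e_gt: "- 1 < e s"
proof -
  have "h s - b1 s < sqrt (disc s)"
  proof (cases "h s \<le> b1 s")
    case True
    then show ?thesis using disc_pos[of s] by (smt (verit) real_sqrt_gt_zero)
  next
    case False
    have "h s * (h s + b2 s) < h s * (2 * b1 s)"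
      using b1_pos(3)[of s] h_pos[of s] by (intro mult_strict_left_mono)
    then have "(h s - b1 s)\<^sup>2 < disc s" by (simp add: disc_def power2_eq_square algebra_simps)
    then show ?thesis by (rule real_less_rsqrt)
  qed
  then show ?thesis unfolding e_def using denom_pos[of s] by (simp add: pos_less_divide_eq)
qed

lemma A_\<xi>_direction: "A (\<xi> s) \<bullet> (p s - \<xi> s) = - h s"
  by (simp add: inner_diff_right A_\<xi>_p on_surface h_def)

lemma A_d_direction: "A (d s) \<bullet> (p s - \<xi> s) = - b1 s"
  by (simp add: inner_diff_right A_d_p b1_def inner_diag_sym[of _ "d s" "\<xi> s"])

lemma DERIV_h: "(h has_real_derivative - 2 * r s * h s) (at s)"
proof -
  have "((\<lambda>s. (x0 s)\<^sup>2 / \<alpha>) has_real_derivative 2 * (y0 s * x0 s) / \<alpha>) (at s)"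
    using DERIV_cdivide[OF DERIV_power[OF DERIV_x0[of s], of 2], of \<alpha>] by simp
  moreover have "2 * (y0 s * x0 s) / \<alpha> = - 2 * r s * h s"
    unfolding y0_eq[of s] h_def by (simp add: power2_eq_square)
  ultimately show ?thesis unfolding h_def[symmetric] by simp
qed

lemma DERIV_b1: "(b1 has_real_derivative - r s * b1 s - r s * h s + k s * b1 s) (at s)"
proof -
  have eq: "A (\<xi> s) \<bullet> (\<eta> s + k s *\<^sub>R d s) + A (\<eta> s) \<bullet> d s = - r s * b1 s - r s * h s + k s * b1 s"
    unfolding \<eta>_eq[of s] linear_cmul[OF linear_diag] inner_scaleR_left inner_scaleR_right inner_add_right
      inner_diag_sym[of _ "p s - \<xi> s" "d s"] A_\<xi>_direction A_d_direction
    by (simp add: b1_def)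
  show ?thesis
    using has_real_derivative_inner[OF has_vector_derivative_diag[OF DERIV_\<xi>] DERIV_d, of "\<lambda>j. 1 / a j" s]
    unfolding eq b1_def[symmetric] .
qed

lemma DERIV_b2: "(b2 has_real_derivative - 2 * r s * b1 s + 2 * k s * b2 s) (at s)"
proof -
  have *: "A (d s) \<bullet> (\<eta> s + k s *\<^sub>R d s) = - r s * b1 s + k s * b2 s"
    unfolding \<eta>_eq[of s] inner_scaleR_right inner_add_right A_d_direction by (simp add: b2_def)
  have eq: "A (d s) \<bullet> (\<eta> s + k s *\<^sub>R d s) + A (\<eta> s + k s *\<^sub>R d s) \<bullet> d s = - 2 * r s * b1 s + 2 * k s * b2 s"
    unfolding inner_diag_sym[of _ "\<eta> s + k s *\<^sub>R d s" "d s"] * by simp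
  show ?thesis
    using has_real_derivative_inner[OF has_vector_derivative_diag[OF DERIV_d] DERIV_d, of "\<lambda>j. 1 / a j" s]
    unfolding eq b2_def[symmetric] .
qed

text \<open>The explicit formula gives differentiability only; the value comes from differentiating
  the quadratic equation.\<close>

lemma DERIV_e: "(e has_real_derivative - e s * (k s + r s + r s * e s)) (at s)"
proof -
  obtain D where "(disc has_real_derivative D) (at s)"
    using DERIV_diff[OF DERIV_power[OF DERIV_b1[of s], of 2] DERIV_mult[OF DERIV_h DERIV_b2]]
    unfolding disc_def[symmetric] by blast
  note D = DERIV_chain2[OF DERIV_real_sqrt[OF disc_pos[of s]] this]
  from DERIV_divide[OF DERIV_minus[OF DERIV_h] DERIV_add[OF DERIV_b1 D]] denom_pos[of s]
  have "\<exists>e'. (e has_real_derivative e') (at s)"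
    unfolding e_def[symmetric] by auto
  then obtain e' where e': "(e has_real_derivative e') (at s)" ..
  let ?D = "- 2 * r s * h s + (2 * e' * b1 s + 2 * e s * (- r s * b1 s - r s * h s + k s * b1 s))
    + (2 * e s * e' * b2 s + (e s)\<^sup>2 * (- 2 * r s * b1 s + 2 * k s * b2 s))"
  have "((\<lambda>s. h s + 2 * e s * b1 s + (e s)\<^sup>2 * b2 s) has_real_derivative ?D) (at s)"
    using DERIV_add[OF DERIV_add[OF DERIV_h[of s] DERIV_mult[OF DERIV_cmult[OF e', of 2] DERIV_b1]]
        DERIV_mult[OF DERIV_power[OF e', of 2] DERIV_b2]]
    by (rule DERIV_cong) (simp add: power2_eq_square algebra_simps)
  moreover have "((\<lambda>s. h s + 2 * e s * b1 s + (e s)\<^sup>2 * b2 s) has_real_derivative 0) (at s)"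
    unfolding e_root by simp
  ultimately have "?D = 0" by (rule DERIV_unique)
  \<comment> \<open>The multiple of the quadratic polynomial split off here vanishes by
    \<open>e_root\<close>; the rest carries the nonzero factor \<open>b1 + e b2\<close>.\<close>
  moreover have "?D = 2 * (e' + e s * (k s + r s + r s * e s)) * (b1 s + e s * b2 s)
      - 2 * r s * (1 + e s) * (h s + 2 * e s * b1 s + (e s)\<^sup>2 * b2 s)"
    by (simp add: power2_eq_square algebra_simps)
  ultimately have "2 * (e' + e s * (k s + r s + r s * e s)) * (b1 s + e s * b2 s) = 0"
    unfolding e_root by linarith
  then have "e' + e s * (k s + r s + r s * e s) = 0"
    using e_derivative_nonzero[of s] unfolding mult_eq_0_iff by simp
  then have "e' = - e s * (k s + r s + r s * e s)" by simp
  then show ?thesis using e' by simp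
qed

section \<open>The curve \<open>g\<close> as a geodesic of the neck\<close>

definition \<rho> where "\<rho> s = (1 + e s) * r s"
definition V where "V s = norm (p s - g s)"
definition U where "U s = (1 / V s) *\<^sub>R (p s - g s)"

text \<open>The law for \<open>e'\<close> cancels the terms with \<open>k\<close> and leaves
  \<open>(1 + e) r\<close> times \<open>p - \<xi> - e d\<close>.\<close>

lemma DERIV_g: "(g has_vector_derivative \<rho> s *\<^sub>R (p s - g s)) (at s)"
proof -
  have "\<eta> s + (e s *\<^sub>R (\<eta> s + k s *\<^sub>R d s) + (- e s * (k s + r s + r s * e s)) *\<^sub>R d s) = \<rho> s *\<^sub>R (p s - g s)"
    unfolding \<eta>_eq[of s] g_def \<rho>_def by (simp add: vec_eq_iff algebra_simps)
  then show ?thesis unfolding g_def[abs_def]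
    using has_vector_derivative_add[OF DERIV_\<xi> has_vector_derivative_scaleR[OF DERIV_e DERIV_d], of s]
    by (simp add: g_def)
qed

lemma A_g_g: "A (g s) \<bullet> g s = 1"
  using A_quadratic[of s "e s"] e_root[of s] by (simp add: g_def)

lemma A_g_p: "A (g s) \<bullet> p s = 1"
  by (simp add: g_def inner_simps A_\<xi>_p A_d_p)

lemma DERIV_p_minus_g:
  "((\<lambda>s. p s - g s) has_vector_derivative
     (k s / (1 + e s) - \<rho> s) *\<^sub>R (p s - g s) + (- k s * \<alpha> / (1 + e s)) *\<^sub>R A (g s)) (at s)"
proof -
  have e1: "1 + e s > 0" using e_gt[of s] by simp
  \<comment> \<open>The factor \<open>1 + e\<close> turns \<open>d + \<alpha> A d\<close> into an
    expression in \<open>g\<close> and \<open>p\<close> alone.\<close>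
  have "(1 + e s) *\<^sub>R (d s + \<alpha> *\<^sub>R A (d s)) = (d s + \<alpha> *\<^sub>R A (d s)) + e s *\<^sub>R (d s + \<alpha> *\<^sub>R A (d s))"
    by (simp add: algebra_simps)
  also have "\<dots> = \<xi> s + \<alpha> *\<^sub>R A (\<xi> s) - p s + e s *\<^sub>R (d s + \<alpha> *\<^sub>R A (d s))"
    by (simp only: d_add_Ad)
  also have "\<dots> = g s - p s + \<alpha> *\<^sub>R A (g s)"
    unfolding g_def by (simp add: algebra_simps)
  finally have "(1 / (1 + e s)) *\<^sub>R ((1 + e s) *\<^sub>R (d s + \<alpha> *\<^sub>R A (d s))) =
      (1 / (1 + e s)) *\<^sub>R (g s - p s + \<alpha> *\<^sub>R A (g s))" by (rule arg_cong)
  then have eq: "d s + \<alpha> *\<^sub>R A (d s) = (1 / (1 + e s)) *\<^sub>R (g s - p s + \<alpha> *\<^sub>R A (g s))"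
    unfolding scaleR_scaleR[of _ "1 + e s"] using e1 by simp
  have "- k s *\<^sub>R (d s + \<alpha> *\<^sub>R A (d s)) - \<rho> s *\<^sub>R (p s - g s) =
      (k s / (1 + e s) - \<rho> s) *\<^sub>R (p s - g s) + (- k s * \<alpha> / (1 + e s)) *\<^sub>R A (g s)"
    unfolding eq by (simp add: algebra_simps)
  then show ?thesis using has_vector_derivative_diff[OF DERIV_p DERIV_g, of s] by simp
qed

text \<open>Since \<open>A g . g = A g . p = 1\<close>, the form \<open>A\<close> at
  \<open>p - g\<close> is \<open>(A - B) p . p = \<alpha> A B p . p\<close>, and
  \<open>B p . p = 1\<close> bounds this below by \<open>\<alpha> / M\<close>.\<close>

lemma V_ge: "\<alpha> / (M * c) \<le> (V s)\<^sup>2"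
proof -
  have "A (p s - g s) \<bullet> (p s - g s) = (A (p s) - B (p s)) \<bullet> p s"
    using A_g_g[of s] A_g_p[of s] inner_diag_sym[of "\<lambda>j. 1 / a j" "p s" "g s"]
    by (simp add: inner_simps B_p_p)
  also have "A (p s) - B (p s) = \<alpha> *\<^sub>R A (B (p s))" using B_add_AB[of "p s"] by (simp add: algebra_simps)
  finally have 1: "A (p s - g s) \<bullet> (p s - g s) = \<alpha> * (A (B (p s)) \<bullet> p s)" by simp
  have "diag (\<lambda>j. 1 / M * (1 / (a j + \<alpha>))) (p s) \<bullet> p s \<le> diag (\<lambda>j. 1 / a j * (1 / (a j + \<alpha>))) (p s) \<bullet> p s"
    using a_\<alpha>_pos by (intro inner_diag_self_mono mult_right_mono inverse_M_le) (simp add: less_imp_le)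
  moreover have "diag (\<lambda>j. 1 / M * (1 / (a j + \<alpha>))) (p s) = (1 / M) *\<^sub>R B (p s)"
    "diag (\<lambda>j. 1 / a j * (1 / (a j + \<alpha>))) (p s) = A (B (p s))"
    by (simp_all add: vec_eq_iff)
  ultimately have "1 / M \<le> A (B (p s)) \<bullet> p s" by (simp add: B_p_p)
  then have "\<alpha> * (1 / M) \<le> A (p s - g s) \<bullet> (p s - g s)"
    unfolding 1 using \<alpha>_pos by (intro mult_left_mono) auto
  also have "\<dots> \<le> c * ((p s - g s) \<bullet> (p s - g s))" by (intro inner_diag_self_le inverse_a_le_c)
  also have "\<dots> = c * (V s)\<^sup>2" by (simp add: V_def power2_norm_eq_inner)
  finally show ?thesis using c_pos M_pos by (simp add: field_simps)
qed

lemma V_pos: "0 < V s"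
proof -
  have "0 < \<alpha> / (M * c)" using \<alpha>_pos M_pos c_pos by simp
  then have "V s \<noteq> 0" using V_ge[of s] by auto
  then show ?thesis by (simp add: V_def)
qed

lemma unit_tangent_g: "unit_tangent a (g s) (U s)"
  using V_pos[of s] A_g_g[of s] A_g_p[of s]
  by (simp add: unit_tangent_def U_def inner_diff_right flip: power2_norm_eq_inner)
     (simp add: V_def power2_eq_square)

lemma DERIV_g_U: "(g has_vector_derivative (\<rho> s * V s) *\<^sub>R U s) (at s)"
  using DERIV_g[of s] V_pos[of s] by (simp add: U_def)

lemma DERIV_U: "(U has_vector_derivative (\<rho> s * V s) *\<^sub>R ellipsoid_accel a (g s) (U s)) (at s)"
proof -
  define m where "m = - k s * \<alpha> / (1 + e s) / V s"
  have "(U has_vector_derivative m *\<^sub>R A (g s)) (at s)"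
    unfolding U_def[abs_def] V_def m_def
  proof (rule has_vector_derivative_normalize[OF DERIV_p_minus_g])
    show "(p s - g s) \<bullet> A (g s) = 0"
      using A_g_g[of s] A_g_p[of s] unfolding inner_commute[of "p s - g s"] by (simp add: inner_diff_right)
    show "p s - g s \<noteq> 0" using V_pos[of s] by (auto simp: V_def)
  qed
  note U' = this
  \<comment> \<open>The coefficient \<open>m\<close> need not be evaluated from \<open>k\<close>:
    differentiating the tangency \<open>A g . U = 0\<close> identifies it as that of the geodesic
    acceleration.\<close>
  have "((\<lambda>s. A (g s) \<bullet> U s) has_real_derivative A (g s) \<bullet> (m *\<^sub>R A (g s)) + A ((\<rho> s * V s) *\<^sub>R U s) \<bullet> U s) (at s)"
    by (rule has_real_derivative_inner[OF has_vector_derivative_diag[OF DERIV_g_U] U'])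
  moreover have "((\<lambda>s. A (g s) \<bullet> U s) has_real_derivative 0) (at s)"
    using unit_tangent_g by (simp add: unit_tangent_def)
  ultimately have eq: "A (g s) \<bullet> (m *\<^sub>R A (g s)) + A ((\<rho> s * V s) *\<^sub>R U s) \<bullet> U s = 0"
    by (rule DERIV_unique)
  have "A (g s) \<noteq> 0" using A_g_g[of s] by auto
  then have "A (g s) \<bullet> A (g s) > 0" by simp
  then have "m = - (\<rho> s * V s) * ((A (U s) \<bullet> U s) / (A (g s) \<bullet> A (g s)))"
    using eq by (simp add: field_simps)
  then show ?thesis using U' by (simp add: ellipsoid_accel_def)
qed

section \<open>Estimates uniform in \<open>s >= 0\<close>\<close>

lemma x0_le: "x0 s \<le> x0 0" if "s \<ge> 0"
  using that DERIV_x0 y0_neg by (meson DERIV_nonpos_imp_nonincreasing less_imp_le)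

lemma h_le: "h s \<le> x0 0 / \<alpha> * x0 s" if "s \<ge> 0"
  unfolding h_def power2_eq_square using x0_le[OF that] x0_pos[of s] \<alpha>_pos
  by (simp add: divide_right_mono mult_right_mono)

lemma inner_le_A: "v \<bullet> v \<le> M * (A v \<bullet> v)"
  using inner_diag_self_ge[of "1 / M" "\<lambda>j. 1 / a j" v] inverse_M_le M_pos by (simp add: field_simps)

lemma norm_\<xi>_le: "norm (\<xi> s) \<le> sqrt (M * (1 + (x0 0)\<^sup>2 / \<alpha>))" if "s \<ge> 0"
proof (rule real_le_rsqrt)
  have "(norm (\<xi> s))\<^sup>2 \<le> M * (1 + (x0 s)\<^sup>2 / \<alpha>)"
    using inner_le_A[of "\<xi> s"] unfolding on_surface by (simp add: power2_norm_eq_inner)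
  also have "\<dots> \<le> M * (1 + (x0 0)\<^sup>2 / \<alpha>)"
    using x0_le[OF that] x0_pos[of s] M_pos \<alpha>_pos
    by (intro mult_left_mono add_left_mono divide_right_mono power_mono) auto
  finally show "(norm (\<xi> s))\<^sup>2 \<le> M * (1 + (x0 0)\<^sup>2 / \<alpha>)" .
qed

lemma norm_p_le: "norm (p s) \<le> sqrt (M + \<alpha>)"
proof (rule real_le_rsqrt)
  have "1 / (M + \<alpha>) * (p s \<bullet> p s) \<le> B (p s) \<bullet> p s"
    using a_\<alpha>_pos a_le_M by (intro inner_diag_self_ge frac_le) (auto simp: less_imp_le)
  then show "(norm (p s))\<^sup>2 \<le> M + \<alpha>"
    using B_p_p[of s] M_pos \<alpha>_pos by (simp add: power2_norm_eq_inner field_simps)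
qed

text \<open>The pole \<open>\<xi> - d\<close> lies inside the neck, hence within
  \<open>sqrt M\<close> of the origin.\<close>

lemma norm_d_le: "norm (d s) \<le> sqrt (M * (1 + (x0 0)\<^sup>2 / \<alpha>)) + sqrt M" if "s \<ge> 0"
proof -
  have "A (\<xi> s - d s) \<bullet> (\<xi> s - d s) = 1 + h s - 2 * b1 s + b2 s"
    using A_quadratic[of s "- 1"] by simp
  then have "A (\<xi> s - d s) \<bullet> (\<xi> s - d s) \<le> 1" using b1_pos(3)[of s] by linarith
  then have "M * (A (\<xi> s - d s) \<bullet> (\<xi> s - d s)) \<le> M * 1" using M_pos by (intro mult_left_mono) auto
  then have "(norm (\<xi> s - d s))\<^sup>2 \<le> M"
    using inner_le_A[of "\<xi> s - d s"] unfolding power2_norm_eq_inner by linarith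
  then have "norm (\<xi> s - d s) \<le> sqrt M" by (rule real_le_rsqrt)
  moreover have "norm (d s) \<le> norm (\<xi> s) + norm (\<xi> s - d s)"
    using norm_triangle_ineq4[of "\<xi> s" "\<xi> s - d s"] by simp
  ultimately show ?thesis using norm_\<xi>_le[OF that] by linarith
qed

lemma e_nonpos: "e s \<le> 0"
  unfolding e_def using h_pos[of s] denom_pos[of s] by (simp add: divide_nonpos_pos)

lemma abs_e_le: "\<bar>e s\<bar> \<le> 2 / gap * h s"
proof -
  have "\<bar>e s\<bar> = h s / (b1 s + sqrt (disc s))"
    unfolding e_def using h_pos[of s] denom_pos[of s] by simp
  also have "\<dots> \<le> h s / (gap / 2)"
    using b1_pos(1)[of s] gap_pos disc_pos[of s] h_pos[of s]
    by (intro divide_left_mono) (auto intro: add_increasing2 mult_pos_pos denom_pos)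
  finally show ?thesis by (simp add: mult.commute)
qed

text \<open>The quadratic polynomial defining \<open>e s\<close> is at most \<open>- gap\<close> at \<open>- 1\<close>.\<close>

lemma e_ge: "gap \<le> (1 + e s) * (2 * b1 s)"
proof -
  have "gap \<le> 2 * b1 s - h s - b2 s" using two_b1[of s] by simp
  also have "\<dots> = (1 + e s) * (2 * b1 s + b2 s * (e s - 1))"
    using e_root[of s] by (simp add: power2_eq_square algebra_simps)
  also have "\<dots> \<le> (1 + e s) * (2 * b1 s)"
  proof (rule mult_left_mono)
    have "b2 s * (e s - 1) \<le> 0" using b2_nonneg[of s] e_nonpos[of s] by (intro mult_nonneg_nonpos) auto
    then show "2 * b1 s + b2 s * (e s - 1) \<le> 2 * b1 s" by simp
  qed (use e_gt[of s] in simp)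
  finally show ?thesis .
qed

text \<open>Here \<open>b1 = 1 + h - B p . \<xi>\<close>, and
  \<open>B (\<xi> + p) . (\<xi> + p) >= 0\<close> bounds \<open>B p . \<xi>\<close> below. With
  \<open>e_ge\<close> this keeps \<open>1 + e\<close> away from 0.\<close>

lemma b1_le: "2 * b1 s \<le> 4 + 3 * h s"
proof -
  have d: "d s = \<xi> s - (p s - \<alpha> *\<^sub>R B (p s))" by (simp add: d_def)
  have "A (\<xi> s) \<bullet> (p s - \<alpha> *\<^sub>R B (p s)) = A (p s - \<alpha> *\<^sub>R B (p s)) \<bullet> \<xi> s"
    by (rule inner_diag_sym)
  also have "A (p s - \<alpha> *\<^sub>R B (p s)) = B (p s)"
    using B_add_AB[of "p s"] by (simp add: algebra_simps)
  finally have b1: "b1 s = 1 + h s - B (p s) \<bullet> \<xi> s"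
    unfolding b1_def d inner_diff_right[of _ "\<xi> s"] on_surface h_def by simp
  have "0 \<le> B (\<xi> s + p s) \<bullet> (\<xi> s + p s)" by (rule B_nonneg)
  also have "\<dots> = B (\<xi> s) \<bullet> \<xi> s + 2 * (B (p s) \<bullet> \<xi> s) + 1"
    using inner_diag_sym[of "\<lambda>j. 1 / (a j + \<alpha>)" "\<xi> s" "p s"] B_p_p[of s]
    by (simp add: inner_simps)
  finally have "0 \<le> (1 + h s) + 2 * (B (p s) \<bullet> \<xi> s) + 1"
    using B_le_A[of "\<xi> s"] on_surface[of s] by (simp add: h_def)
  then show ?thesis using b1 by simp
qed

text \<open>The unit velocity is \<open>r\<close> times \<open>(- x0, p - \<xi>)\<close>, a vector
  that stays bounded for \<open>s >= 0\<close>.\<close>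

lemma r_bounded_below: "\<exists>\<kappa>>0. \<forall>s\<ge>0. \<kappa> \<le> r s"
proof -
  define K where "K = x0 0 + (sqrt (M + \<alpha>) + sqrt (M * (1 + (x0 0)\<^sup>2 / \<alpha>)))"
  have K: "K > 0"
    unfolding K_def using x0_pos[of 0] M_pos \<alpha>_pos by (intro add_pos_nonneg) auto
  have "1 / K \<le> r s" if s: "s \<ge> 0" for s
  proof -
    have "\<bar>y0 s\<bar> = r s * x0 s" "norm (\<eta> s) = r s * norm (p s - \<xi> s)"
      unfolding y0_eq[of s] \<eta>_eq[of s] using r_pos[of s] x0_pos[of s] by (simp_all add: abs_mult)
    moreover have "1 \<le> \<bar>y0 s\<bar> + norm (\<eta> s)"
    proof -
      have "1 = (y0 s)\<^sup>2 + (norm (\<eta> s))\<^sup>2" using unit_speed[of s] by (simp add: power2_norm_eq_inner)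
      also have "\<dots> \<le> (\<bar>y0 s\<bar> + norm (\<eta> s))\<^sup>2" by (simp add: power2_sum)
      finally show ?thesis using power2_le_imp_le[of 1 "\<bar>y0 s\<bar> + norm (\<eta> s)"] by simp
    qed
    ultimately have "1 \<le> r s * (x0 s + norm (p s - \<xi> s))" by (simp add: distrib_left)
    also have "\<dots> \<le> r s * K"
      unfolding K_def using r_pos[of s] x0_le[OF s] norm_p_le[of s] norm_\<xi>_le[OF s]
      by (intro mult_left_mono add_mono order_trans[OF norm_triangle_ineq4]) auto
    finally show ?thesis using K by (simp add: pos_divide_le_eq)
  qed
  then show ?thesis using K by (intro exI[of _ "1 / K"]) auto
qed

lemma asymptotic_to_ellipsoid_geodesic:
  "\<exists>\<Gamma> W C \<kappa>. (\<forall>t. (\<Gamma> has_vector_derivative W t) (at t)) \<and>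
     (\<forall>t. (W has_vector_derivative ellipsoid_accel a (\<Gamma> t) (W t)) (at t)) \<and>
     (\<forall>t. unit_tangent a (\<Gamma> t) (W t)) \<and> \<kappa> > 0 \<and>
     (\<forall>s\<ge>0. \<exists>t. \<bar>x0 s\<bar> + norm (\<xi> s - \<Gamma> t) \<le> C * exp (- \<kappa> * s))"
proof -
  obtain \<kappa> where \<kappa>: "\<kappa> > 0" "\<And>s. s \<ge> 0 \<Longrightarrow> \<kappa> \<le> r s" using r_bounded_below by blast
  have decay: "x0 s \<le> x0 0 * exp (- \<kappa> * s)" if s: "s \<ge> 0" for s
  proof -
    have "x0 s * exp (\<kappa> * s) \<le> x0 0 * exp (\<kappa> * 0)"
    proof (rule DERIV_nonpos_imp_nonincreasing[OF s])
      fix t :: real assume t: "0 \<le> t"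
      have "((\<lambda>s. x0 s * exp (\<kappa> * s)) has_real_derivative (\<kappa> - r t) * (x0 t * exp (\<kappa> * t))) (at t)"
        using y0_eq[of t] by (auto intro!: derivative_eq_intros DERIV_x0 simp: algebra_simps)
      moreover have "(\<kappa> - r t) * (x0 t * exp (\<kappa> * t)) \<le> 0"
        using \<kappa>(2)[OF t] x0_pos[of t] by (intro mult_nonpos_nonneg) auto
      ultimately show "\<exists>y. ((\<lambda>s. x0 s * exp (\<kappa> * s)) has_real_derivative y) (at t) \<and> y \<le> 0"
        by blast
    qed
    then show ?thesis by (simp add: exp_minus field_simps)
  qed
  define H where "H = x0 0 / \<alpha> * x0 0"
  have H: "h s \<le> H" if "s \<ge> 0" for s
  proof -
    have "x0 0 / \<alpha> * x0 s \<le> H"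
      unfolding H_def using x0_le[OF that] x0_pos[of 0] \<alpha>_pos by (intro mult_left_mono) auto
    then show ?thesis using h_le[OF that] by linarith
  qed
  have H0: "0 \<le> H" using H[of 0] h_pos[of 0] by simp
  \<comment> \<open>The three factors bound \<open>1 + e\<close>, \<open>r\<close> and
    \<open>V\<close> from below.\<close>
  define v0 where "v0 = gap / (4 + 3 * H) * \<kappa> * sqrt (\<alpha> / (M * c))"
  have v0: "0 < v0"
    unfolding v0_def using gap_pos H0 \<kappa> \<alpha>_pos M_pos c_pos
    by (intro mult_pos_pos divide_pos_pos real_sqrt_gt_zero) auto
  have low: "v0 \<le> \<rho> s * V s" if s: "s \<ge> 0" for s
  proof -
    have "gap \<le> (1 + e s) * (4 + 3 * H)"
      using e_ge[of s] mult_left_mono[of "2 * b1 s" "4 + 3 * H" "1 + e s"] b1_le[of s] H[OF s] e_gt[of s]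
      by linarith
    then have "gap / (4 + 3 * H) \<le> 1 + e s" using H0 by (simp add: pos_divide_le_eq)
    moreover have "sqrt (\<alpha> / (M * c)) \<le> V s"
      using V_ge[of s] V_pos[of s] by (intro real_le_lsqrt) auto
    ultimately show ?thesis
      unfolding v0_def \<rho>_def using \<kappa>(1) \<kappa>(2)[OF s] e_gt[of s] r_pos[of s] gap_pos H0 \<alpha>_pos M_pos c_pos
      by (intro mult_mono mult_nonneg_nonneg divide_nonneg_pos) auto
  qed
  have contV: "continuous_on {0..} (\<lambda>s. \<rho> s * V s)"
  proof -
    have "isCont (\<lambda>s. \<rho> s * V s) s" for s
      unfolding \<rho>_def V_def
      using DERIV_isCont[OF DERIV_e] DERIV_isCont[OF DERIV_r] has_vector_derivative_continuous[OF DERIV_p]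
        has_vector_derivative_continuous[OF DERIV_g]
      by (intro continuous_intros)
    then show ?thesis by (simp add: continuous_at_imp_continuous_on)
  qed
  obtain \<Gamma> W where \<Gamma>: "\<And>t. (\<Gamma> has_vector_derivative W t) (at t)"
    "\<And>t. (W has_vector_derivative ellipsoid_accel a (\<Gamma> t) (W t)) (at t)"
    "\<And>t. unit_tangent a (\<Gamma> t) (W t)" "\<And>s. s \<ge> 0 \<Longrightarrow> g s \<in> range \<Gamma>"
  proof (rule ellipsoid_geodesic_extension[of a "\<lambda>s. \<rho> s * V s" v0 g U])
    show "(g has_vector_derivative (\<rho> s * V s) *\<^sub>R U s) (at s within {0..})" for s
      by (rule has_vector_derivative_at_within[OF DERIV_g_U])
    show "(U has_vector_derivative (\<rho> s * V s) *\<^sub>R ellipsoid_accel a (g s) (U s)) (at s within {0..})" for s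
      by (rule has_vector_derivative_at_within[OF DERIV_U])
  qed (use a_pos contV low v0 unit_tangent_g that in auto)
  define D where "D = sqrt (M * (1 + (x0 0)\<^sup>2 / \<alpha>)) + sqrt M"
  have D: "0 \<le> D" using norm_d_le[of 0] norm_ge_zero[of "d 0"] unfolding D_def by linarith
  \<comment> \<open>The summand 1 accounts for \<open>x0\<close>, the rest for
    \<open>\<bar>e\<bar> * norm d\<close>.\<close>
  define C where "C = 1 + 2 / gap * (x0 0 / \<alpha>) * D"
  have "\<exists>t. \<bar>x0 s\<bar> + norm (\<xi> s - \<Gamma> t) \<le> (C * x0 0) * exp (- \<kappa> * s)" if s: "s \<ge> 0" for s
  proof -
    obtain t where t: "g s = \<Gamma> t" using \<Gamma>(4)[OF s] by auto
    have "norm (\<xi> s - g s) = \<bar>e s\<bar> * norm (d s)" by (simp add: g_def)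
    also have "\<dots> \<le> (2 / gap * (x0 0 / \<alpha> * x0 s)) * D"
    proof (intro mult_mono)
      have "2 / gap * h s \<le> 2 / gap * (x0 0 / \<alpha> * x0 s)"
        using h_le[OF s] gap_pos by (intro mult_left_mono) auto
      then show "\<bar>e s\<bar> \<le> 2 / gap * (x0 0 / \<alpha> * x0 s)" using abs_e_le[of s] by linarith
      then show "0 \<le> 2 / gap * (x0 0 / \<alpha> * x0 s)" by linarith
      show "norm (d s) \<le> D" unfolding D_def by (rule norm_d_le[OF s])
    qed simp
    finally have "\<bar>x0 s\<bar> + norm (\<xi> s - g s) \<le> C * x0 s"
      unfolding C_def using x0_pos[of s] by (simp add: algebra_simps)
    also have "\<dots> \<le> C * (x0 0 * exp (- \<kappa> * s))"
      unfolding C_def using decay[OF s] D gap_pos \<alpha>_pos x0_pos[of 0]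
      by (intro mult_left_mono add_nonneg_nonneg mult_nonneg_nonneg divide_nonneg_pos) auto
    finally show ?thesis unfolding t by (intro exI[of _ t]) (simp add: mult.assoc)
  qed
  then show ?thesis using \<Gamma>(1-3) \<kappa>(1) by blast
qed

end

section \<open>Removal of the sign assumptions\<close>

context hyperboloid_geodesic begin

text \<open>At a zero of \<open>y0\<close> off the neck, \<open>w = x0 \<eta>\<close> is nonzero and
  \<open>F = - B w . w < 0\<close>.\<close>

lemma y0_nonzero:
  assumes "F = 0" "x0 s \<noteq> 0" shows "y0 s \<noteq> 0"
proof
  assume y: "y0 s = 0"
  then have "\<eta> s \<noteq> 0" using unit_speed[of s] by auto
  then have "w s \<noteq> 0" using assms(2) y by (simp add: w_def)
  then have "0 < B (w s) \<bullet> w s" using a_\<alpha>_pos by (intro inner_diag_self_pos) auto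
  then show False using F_eq[of s] assms(1) y by simp
qed

lemma asymptotic_of_pos:
  assumes F: "F = 0" and pos: "\<And>s. 0 < x0 s"
  shows "\<exists>\<Gamma> W C \<kappa>. (\<forall>t. (\<Gamma> has_vector_derivative W t) (at t)) \<and>
     (\<forall>t. (W has_vector_derivative ellipsoid_accel a (\<Gamma> t) (W t)) (at t)) \<and>
     (\<forall>t. unit_tangent a (\<Gamma> t) (W t)) \<and> \<kappa> > 0 \<and>
     ((\<forall>s\<ge>0. \<exists>t. \<bar>x0 s\<bar> + norm (\<xi> s - \<Gamma> t) \<le> C * exp (- \<kappa> * \<bar>s\<bar>)) \<or>
      (\<forall>s\<le>0. \<exists>t. \<bar>x0 s\<bar> + norm (\<xi> s - \<Gamma> t) \<le> C * exp (- \<kappa> * \<bar>s\<bar>)))"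
proof -
  have nz: "y0 s \<noteq> 0" for s using y0_nonzero[OF F] pos[of s] by simp
  then have "(\<forall>s. y0 s < 0) \<or> (\<forall>s. 0 < y0 s)"
    using real_IVT_zero[OF continuous_y0] by (metis linorder_neqE_linordered_idom)
  then show ?thesis
  proof
    assume "\<forall>s. y0 s < 0"
    then interpret asymptotic_geodesic \<alpha> a x0 y0 \<xi> \<eta> \<mu>
      using F pos by unfold_locales auto
    obtain \<Gamma> W C \<kappa> where "\<forall>t. (\<Gamma> has_vector_derivative W t) (at t)"
      "\<forall>t. (W has_vector_derivative ellipsoid_accel a (\<Gamma> t) (W t)) (at t)"
      "\<forall>t. unit_tangent a (\<Gamma> t) (W t)" "\<kappa> > 0"
      "\<forall>s\<ge>0. \<exists>t. \<bar>x0 s\<bar> + norm (\<xi> s - \<Gamma> t) \<le> C * exp (- \<kappa> * s)"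
      using asymptotic_to_ellipsoid_geodesic by metis
    then show ?thesis by (intro exI[of _ \<Gamma>] exI[of _ W] exI[of _ C] exI[of _ \<kappa>]) auto
  next
    assume neg: "\<forall>s. 0 < y0 s"
    interpret R: hyperboloid_geodesic \<alpha> a "\<lambda>s. x0 (- s)" "\<lambda>s. - y0 (- s)" "\<lambda>s. \<xi> (- s)" "\<lambda>s. - \<eta> (- s)" "\<lambda>s. \<mu> (- s)"
      by (rule reverse)
    interpret R: asymptotic_geodesic \<alpha> a "\<lambda>s. x0 (- s)" "\<lambda>s. - y0 (- s)" "\<lambda>s. \<xi> (- s)" "\<lambda>s. - \<eta> (- s)" "\<lambda>s. \<mu> (- s)"
      using F pos neg F_reverse by unfold_locales auto
    obtain \<Gamma> W C \<kappa> where *: "\<forall>t. (\<Gamma> has_vector_derivative W t) (at t)"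
      "\<forall>t. (W has_vector_derivative ellipsoid_accel a (\<Gamma> t) (W t)) (at t)"
      "\<forall>t. unit_tangent a (\<Gamma> t) (W t)" "\<kappa> > 0"
      "\<forall>s\<ge>0. \<exists>t. \<bar>x0 (- s)\<bar> + norm (\<xi> (- s) - \<Gamma> t) \<le> C * exp (- \<kappa> * s)"
      using R.asymptotic_to_ellipsoid_geodesic by metis
    have "\<exists>t. \<bar>x0 s\<bar> + norm (\<xi> s - \<Gamma> t) \<le> C * exp (- \<kappa> * \<bar>s\<bar>)" if "s \<le> 0" for s
      using *(5)[rule_format, of "- s"] that by simp
    then show ?thesis using *(1-4) by blast
  qed
qed

lemma asymptotic:
  assumes F: "F = 0" and nz: "\<And>s. x0 s \<noteq> 0"
  shows "\<exists>\<Gamma> W C \<kappa>. (\<forall>t. (\<Gamma> has_vector_derivative W t) (at t)) \<and>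
     (\<forall>t. (W has_vector_derivative ellipsoid_accel a (\<Gamma> t) (W t)) (at t)) \<and>
     (\<forall>t. unit_tangent a (\<Gamma> t) (W t)) \<and> \<kappa> > 0 \<and>
     ((\<forall>s\<ge>0. \<exists>t. \<bar>x0 s\<bar> + norm (\<xi> s - \<Gamma> t) \<le> C * exp (- \<kappa> * \<bar>s\<bar>)) \<or>
      (\<forall>s\<le>0. \<exists>t. \<bar>x0 s\<bar> + norm (\<xi> s - \<Gamma> t) \<le> C * exp (- \<kappa> * \<bar>s\<bar>)))"
proof -
  have "(\<forall>s. 0 < x0 s) \<or> (\<forall>s. 0 < - x0 s)"
    using real_IVT_zero[OF continuous_x0] nz by (metis linorder_neqE_linordered_idom neg_0_less_iff_less)
  then show ?thesis
  proof
    assume "\<forall>s. 0 < x0 s"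
    then show ?thesis by (intro asymptotic_of_pos[OF F]) auto
  next
    assume "\<forall>s. 0 < - x0 s"
    then show ?thesis
      using hyperboloid_geodesic.asymptotic_of_pos[OF negate] F F_negate by simp
  qed
qed

end

section \<open>The embedded hyperboloid\<close>

lemma quadratic_eq: "quadratic a0 a q = (fst q)\<^sup>2 / a0 + diag (\<lambda>j. 1 / a j) (snd q) \<bullet> snd q"
  by (simp add: quadratic_def inner_diag_self)

text \<open>Half the gradient of \<open>quadratic\<close>.\<close>

definition normal_vector :: "real \<Rightarrow> ('n::finite \<Rightarrow> real) \<Rightarrow> real \<times> (real ^ 'n) \<Rightarrow> real \<times> (real ^ 'n)" where
  "normal_vector a0 a q = (fst q / a0, diag (\<lambda>j. 1 / a j) (snd q))"

lemma has_derivative_quadratic: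
  "(quadratic a0 a has_derivative (\<lambda>v. 2 * (normal_vector a0 a q \<bullet> v))) (at q)"
proof -
  have "((\<lambda>q. fst q * fst q * (1 / a0) + diag (\<lambda>j. 1 / a j) (snd q) \<bullet> snd q) has_derivative
      (\<lambda>v. (fst q * fst v + fst v * fst q) * (1 / a0) +
           (diag (\<lambda>j. 1 / a j) (snd q) \<bullet> snd v + diag (\<lambda>j. 1 / a j) (snd v) \<bullet> snd q))) (at q)"
    by (intro has_derivative_add has_derivative_mult_left has_derivative_mult has_derivative_inner
        has_derivative_fst has_derivative_snd has_derivative_ident
        bounded_linear.has_derivative[OF bounded_linear_diag])
  moreover have "(fst q * fst v + fst v * fst q) * (1 / a0) +
      (diag (\<lambda>j. 1 / a j) (snd q) \<bullet> snd v + diag (\<lambda>j. 1 / a j) (snd v) \<bullet> snd q) =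
      2 * (normal_vector a0 a q \<bullet> v)" for v
    by (simp add: normal_vector_def inner_prod_def inner_diag_sym[of _ "snd v" "snd q"] field_simps)
  moreover have "quadratic a0 a = (\<lambda>q. fst q * fst q * (1 / a0) + diag (\<lambda>j. 1 / a j) (snd q) \<bullet> snd q)"
    by (simp add: fun_eq_iff quadratic_eq power2_eq_square)
  ultimately show ?thesis by simp
qed

lemma tangent_space_eq: "tangent_space a0 a q = {v. normal_vector a0 a q \<bullet> v = 0}"
  unfolding tangent_space_def
  using frechet_derivative_at[OF has_derivative_quadratic[of a0 a q]] by (metis mult_eq_0_iff zero_neq_numeral)

text \<open>Subtracting from \<open>z\<close> its projection on \<open>N\<close> leaves a vector in
  the kernel, which is therefore orthogonal to itself.\<close>

lemma orthogonal_to_kernel: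
  fixes z N :: "'a::real_inner"
  assumes "\<And>v. N \<bullet> v = 0 \<Longrightarrow> z \<bullet> v = 0" "N \<noteq> 0"
  shows "z = ((z \<bullet> N) / (N \<bullet> N)) *\<^sub>R N"
proof -
  define v where "v = z - ((z \<bullet> N) / (N \<bullet> N)) *\<^sub>R N"
  have Nv: "N \<bullet> v = 0" using assms(2) by (simp add: v_def inner_diff_right inner_commute)
  have "v \<bullet> v = z \<bullet> v - (z \<bullet> N) / (N \<bullet> N) * (N \<bullet> v)"
    unfolding v_def by (simp only: inner_diff_left inner_scaleR_left)
  then have "v = 0" using assms(1)[OF Nv] Nv by simp
  then show ?thesis by (simp add: v_def)
qed

lemma geodesic_imp_hyperboloid_geodesic:
  fixes a0 :: real and a :: "'n::finite \<Rightarrow> real"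
  assumes a0: "a0 < 0" and a: "\<And>j. 0 < a j" and geo: "geodesic a0 a x"
    and y: "\<And>s. (x has_vector_derivative y s) (at s)"
  shows "\<exists>\<mu>. hyperboloid_geodesic (- a0) a (\<lambda>s. fst (x s)) (\<lambda>s. fst (y s)) (\<lambda>s. snd (x s)) (\<lambda>s. snd (y s)) \<mu>"
proof -
  let ?A = "diag (\<lambda>j. 1 / a j)"
  obtain y' z where x: "\<And>s. x s \<in> hyperboloid a0 a" and y': "\<And>s. (x has_vector_derivative y' s) (at s)"
    and unit: "\<And>s. norm (y' s) = 1" and z: "\<And>s. (y' has_vector_derivative z s) (at s)"
    and orth: "\<And>s v. v \<in> tangent_space a0 a (x s) \<Longrightarrow> z s \<bullet> v = 0"
    using geo unfolding geodesic_def by metis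
  \<comment> \<open>The velocity hidden in \<open>geodesic\<close> is the given one, by uniqueness
    of derivatives.\<close>
  have "y' s = y s" for s using vector_derivative_unique_at[OF y' y] .
  then have "y' = y" by auto
  note unit = unit[unfolded this] and z = z[unfolded this]
  define N where "N s = normal_vector a0 a (x s)" for s
  define \<mu> where "\<mu> s = - ((z s \<bullet> N s) / (N s \<bullet> N s))" for s
  have surf: "(fst (x s))\<^sup>2 / a0 + ?A (snd (x s)) \<bullet> snd (x s) = 1" for s
    using x[of s] by (simp add: hyperboloid_def quadratic_eq)
  have "N s \<noteq> 0" for s
  proof
    assume "N s = 0"
    then have "?A (snd (x s)) = 0" "fst (x s) = 0"
      using a0 by (simp_all add: N_def normal_vector_def zero_prod_def)
    then show False using surf[of s] by simp
  qed
  then have "z s = - \<mu> s *\<^sub>R N s" for s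
    using orthogonal_to_kernel[of "N s" "z s"] orth[of _ s]
    by (simp add: \<mu>_def N_def tangent_space_eq)
  then have zs: "fst (z s) = - \<mu> s * fst (x s) / a0" "snd (z s) = - \<mu> s *\<^sub>R ?A (snd (x s))" for s
    by (simp_all add: N_def normal_vector_def)
  have dfst: "((\<lambda>s. fst (f s)) has_real_derivative fst (f' s)) (at s)"
    and dsnd: "((\<lambda>s. snd (f s)) has_vector_derivative snd (f' s)) (at s)"
    if "\<And>s. (f has_vector_derivative f' s) (at s)" for f f' :: "real \<Rightarrow> real \<times> (real ^ 'n)" and s
    using bounded_linear.has_vector_derivative[OF bounded_linear_fst that]
      bounded_linear.has_vector_derivative[OF bounded_linear_snd that]
    by (simp_all add: has_real_derivative_iff_has_vector_derivative)
  have tang: "fst (x s) * fst (y s) / a0 + ?A (snd (x s)) \<bullet> snd (y s) = 0" for s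
  proof -
    have "((\<lambda>s. (fst (x s))\<^sup>2 / a0 + ?A (snd (x s)) \<bullet> snd (x s)) has_real_derivative
       2 * (fst (y s) * fst (x s)) / a0 + (?A (snd (x s)) \<bullet> snd (y s) + ?A (snd (y s)) \<bullet> snd (x s))) (at s)"
      using DERIV_add[OF DERIV_cdivide[OF DERIV_power[OF dfst[OF y, of s], of 2], of a0]
        has_real_derivative_inner[OF has_vector_derivative_diag[OF dsnd[OF y]] dsnd[OF y]]]
      by simp
    moreover have "((\<lambda>s. (fst (x s))\<^sup>2 / a0 + ?A (snd (x s)) \<bullet> snd (x s)) has_real_derivative 0) (at s)"
      unfolding surf by simp
    ultimately have "2 * (fst (y s) * fst (x s)) / a0 +
        (?A (snd (x s)) \<bullet> snd (y s) + ?A (snd (y s)) \<bullet> snd (x s)) = 0"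
      by (rule DERIV_unique)
    then show ?thesis by (simp add: inner_diag_sym[of _ "snd (y s)" "snd (x s)"] mult.commute)
  qed
  \<comment> \<open>Differentiating the surface equation a second time determines the
    multiplier.\<close>
  have mult: "fst (y s) * fst (y s) / a0 + - \<mu> s * fst (x s) / a0 * fst (x s) / a0
      + (?A (snd (x s)) \<bullet> snd (z s) + ?A (snd (y s)) \<bullet> snd (y s)) = 0" for s
  proof -
    have "((\<lambda>s. fst (x s) * fst (y s) / a0 + ?A (snd (x s)) \<bullet> snd (y s)) has_real_derivative
       (fst (y s) * fst (y s) + fst (z s) * fst (x s)) / a0
       + (?A (snd (x s)) \<bullet> snd (z s) + ?A (snd (y s)) \<bullet> snd (y s))) (at s)"
      by (intro DERIV_add DERIV_cdivide DERIV_mult dfst y z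
          has_real_derivative_inner has_vector_derivative_diag dsnd)
    moreover have "((\<lambda>s. fst (x s) * fst (y s) / a0 + ?A (snd (x s)) \<bullet> snd (y s)) has_real_derivative 0) (at s)"
      unfolding tang by simp
    ultimately have "(fst (y s) * fst (y s) + fst (z s) * fst (x s)) / a0
       + (?A (snd (x s)) \<bullet> snd (z s) + ?A (snd (y s)) \<bullet> snd (y s)) = 0" by (rule DERIV_unique)
    then show ?thesis by (simp add: zs(1) add_divide_distrib diff_divide_distrib)
  qed
  have "hyperboloid_geodesic (- a0) a (\<lambda>s. fst (x s)) (\<lambda>s. fst (y s)) (\<lambda>s. snd (x s)) (\<lambda>s. snd (y s)) \<mu>"
  proof
    show "0 < - a0" using a0 by simp
    show "0 < a j" for j by (rule a)
    fix s
    show "((\<lambda>s. fst (x s)) has_real_derivative fst (y s)) (at s)" by (rule dfst[OF y])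
    show "((\<lambda>s. snd (x s)) has_vector_derivative snd (y s)) (at s)" by (rule dsnd[OF y])
    show "((\<lambda>s. fst (y s)) has_real_derivative \<mu> s / - a0 * fst (x s)) (at s)"
      using dfst[OF z, of s] by (simp add: zs)
    show "((\<lambda>s. snd (y s)) has_vector_derivative - \<mu> s *\<^sub>R ?A (snd (x s))) (at s)"
      using dsnd[OF z, of s] by (simp add: zs)
    show "?A (snd (x s)) \<bullet> snd (x s) = 1 + (fst (x s))\<^sup>2 / - a0" using surf[of s] by simp
    show "?A (snd (x s)) \<bullet> snd (y s) = fst (x s) * fst (y s) / - a0" using tang[of s] by simp
    have "y s \<bullet> y s = 1" using unit[of s] by (simp add: norm_eq_1)
    then show "(fst (y s))\<^sup>2 + snd (y s) \<bullet> snd (y s) = 1"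
      by (simp add: inner_prod_def power2_eq_square)
    show "\<mu> s * (?A (snd (x s)) \<bullet> ?A (snd (x s)) + (fst (x s))\<^sup>2 / (- a0)\<^sup>2) =
        ?A (snd (y s)) \<bullet> snd (y s) - (fst (y s))\<^sup>2 / - a0"
      using mult[of s] a0 by (simp add: zs power2_eq_square distrib_left)
  qed
  then show ?thesis by blast
qed

text \<open>At points of the neck the normal of the hyperboloid has first component 0, so an
  acceleration parallel to \<open>A \<Gamma>\<close> is normal to the whole hyperboloid.\<close>

lemma geodesic_on_neck:
  assumes "\<And>t. (\<Gamma> has_vector_derivative W t) (at t)"
    and "\<And>t. (W has_vector_derivative ellipsoid_accel a (\<Gamma> t) (W t)) (at t)"
    and ut: "\<And>t. unit_tangent a (\<Gamma> t) (W t)"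
  shows "geodesic a0 a (\<lambda>t. (0, \<Gamma> t))" "range (\<lambda>t. (0, \<Gamma> t)) \<subseteq> neck a0 a"
proof -
  have mem: "(0, \<Gamma> t) \<in> hyperboloid a0 a" for t
    using ut[of t] by (simp add: hyperboloid_def quadratic_eq unit_tangent_def)
  then show "range (\<lambda>t. (0, \<Gamma> t)) \<subseteq> neck a0 a" by (auto simp: neck_def)
  have "norm (0 :: real, W t) = 1" for t
    using ut[of t] by (simp add: norm_Pair unit_tangent_def norm_eq_sqrt_inner)
  moreover have "((\<lambda>t. (0 :: real, \<Gamma> t)) has_vector_derivative (0, W t)) (at t)"
    "((\<lambda>t. (0 :: real, W t)) has_vector_derivative (0, ellipsoid_accel a (\<Gamma> t) (W t))) (at t)" for t
    using assms by (auto intro!: has_vector_derivative_Pair)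
  moreover have "(0, ellipsoid_accel a (\<Gamma> t) (W t)) \<bullet> v = 0" if "v \<in> tangent_space a0 a (0, \<Gamma> t)" for t v
    using that by (simp add: tangent_space_eq normal_vector_def inner_prod_def ellipsoid_accel_def)
  ultimately show "geodesic a0 a (\<lambda>t. (0, \<Gamma> t))"
    unfolding geodesic_def using mem
    by (intro conjI allI exI[of _ "\<lambda>t. (0, W t)"] exI[of _ "\<lambda>t. (0, ellipsoid_accel a (\<Gamma> t) (W t))"]) auto
qed

theorem theorem1p1:
  fixes a0 :: real and a :: "'n::{finite,linorder} \<Rightarrow> real"
    and x y :: "real \<Rightarrow> real \<times> (real ^ 'n::{finite,linorder})"
  assumes "a0 < 0" and "\<And>j. 0 < a j" and "strict_mono a"
    and "geodesic a0 a x"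
    and "\<And>s. (x has_vector_derivative y s) (at s)"
  shows "\<exists>c. (\<forall>s. F0 a0 a (x s) (y s) = c) \<and>
             (crosses_neck x \<longleftrightarrow> c > 0) \<and>
             (c < 0 \<longrightarrow> reflected_to_infinity a0 a x) \<and>
             (c = 0 \<longrightarrow> exponentially_approaches_neck_geodesic a0 a x)"
proof -
  obtain \<mu> where
    "hyperboloid_geodesic (- a0) a (\<lambda>s. fst (x s)) (\<lambda>s. fst (y s)) (\<lambda>s. snd (x s)) (\<lambda>s. snd (y s)) \<mu>"
    using geodesic_imp_hyperboloid_geodesic[OF assms(1,2,4,5)] by blast
  then interpret hyperboloid_geodesic "- a0" a "\<lambda>s. fst (x s)" "\<lambda>s. fst (y s)" "\<lambda>s. snd (x s)" "\<lambda>s. snd (y s)" \<mu> .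
  have "F0 a0 a (x s) (y s) = F" for s
  proof -
    have "(fst (x s) * snd (y s) $ j - snd (x s) $ j * fst (y s))\<^sup>2 / (a0 - a j) =
        - (1 / (a j + - a0) * (w s $ j)\<^sup>2)" for j
    proof -
      have "a0 - a j = - (a j + - a0)" by simp
      then show ?thesis by (simp only: divide_minus_right) (simp add: w_def mult.commute)
    qed
    then have "F0 a0 a (x s) (y s) = (fst (y s))\<^sup>2 - B (w s) \<bullet> w s"
      by (simp add: F0_def inner_diag_self sum_negf)
    then show ?thesis using F_eq by simp
  qed
  moreover have "crosses_neck x \<longleftrightarrow> F > 0" using crosses_iff by (simp add: crosses_neck_def)
  moreover have "reflected_to_infinity a0 a x" if "F < 0"
    using reflected[OF that] by (simp add: reflected_to_infinity_def neck_def)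
  moreover have "exponentially_approaches_neck_geodesic a0 a x" if F: "F = 0"
  proof (cases "\<exists>s. fst (x s) = 0")
    \<comment> \<open>One zero of \<open>x0\<close> puts the whole geodesic on the neck, so it
      approaches itself, with constant 0 and any rate.\<close>
    case True
    then have "fst (x s) = 0" for s using F_at_neck(2)[OF _ F] vanishes by blast
    then have "range x \<subseteq> neck a0 a" using assms(4) by (auto simp: neck_def geodesic_def)
    then show ?thesis
      unfolding exponentially_approaches_neck_geodesic_def using assms(4)
      by (intro exI[of _ x] exI[of _ 0] exI[of _ 1]) auto
  next
    case False
    then obtain \<Gamma> W C \<kappa> where \<Gamma>: "\<And>t. (\<Gamma> has_vector_derivative W t) (at t)"
      "\<And>t. (W has_vector_derivative ellipsoid_accel a (\<Gamma> t) (W t)) (at t)"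
      "\<And>t. unit_tangent a (\<Gamma> t) (W t)" and \<kappa>: "\<kappa> > 0" and
      approach: "(\<forall>s\<ge>0. \<exists>t. \<bar>fst (x s)\<bar> + norm (snd (x s) - \<Gamma> t) \<le> C * exp (- \<kappa> * \<bar>s\<bar>)) \<or>
       (\<forall>s\<le>0. \<exists>t. \<bar>fst (x s)\<bar> + norm (snd (x s) - \<Gamma> t) \<le> C * exp (- \<kappa> * \<bar>s\<bar>))"
      using asymptotic[OF F] by metis
    \<comment> \<open>The Euclidean distance is at most the sum of the distances of the
      components.\<close>
    have "infdist (x s) (range (\<lambda>t. (0, \<Gamma> t))) \<le> K"
      if "\<exists>t. \<bar>fst (x s)\<bar> + norm (snd (x s) - \<Gamma> t) \<le> K" for s K
    proof -
      obtain t where t: "\<bar>fst (x s)\<bar> + norm (snd (x s) - \<Gamma> t) \<le> K" using \<open>\<exists>t. _\<close> by blast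
      have "dist (x s) (0, \<Gamma> t) \<le> \<bar>fst (x s)\<bar> + norm (snd (x s) - \<Gamma> t)"
        using sqrt_sum_squares_le_sum_abs[of "fst (x s)" "norm (snd (x s) - \<Gamma> t)"]
        by (simp add: dist_norm norm_prod_def)
      then show ?thesis using t by (intro infdist_le2[of "(0, \<Gamma> t)"]) auto
    qed
    then have "(\<forall>s\<ge>0. infdist (x s) (range (\<lambda>t. (0, \<Gamma> t))) \<le> C * exp (- \<kappa> * \<bar>s\<bar>)) \<or>
        (\<forall>s\<le>0. infdist (x s) (range (\<lambda>t. (0, \<Gamma> t))) \<le> C * exp (- \<kappa> * \<bar>s\<bar>))"
      using approach by meson
    then show ?thesis
      unfolding exponentially_approaches_neck_geodesic_def
      by (intro exI conjI) (rule geodesic_on_neck[OF \<Gamma>] \<kappa> | assumption)+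
  qed
  ultimately show ?thesis by (intro exI[of _ F]) auto
qed

end
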